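(* Fix $0<s<1$, $1<p<\infty$, and an $A_p$ weight $\omega$ in $\mathbb{R}^n$. Suppose that $E\neq\emptyset$ is a compact $\kappa$-porous set (with $0<\kappa<1$), contained in a bounded open set $G\subset\mathbb{R}^n$, and that $R:G\to\mathbb{R}$ is a continuous function satisfying both $R(x)=0$ for every $x\in E$ and $0\le R(x)\le\operatorname{dist}(x,\partial G)$ for every $x\in G$. Then, if $0<t<\kappa\operatorname{diam}(E)/4$ is such that $\overline{E_t}\subset G$, we have $$\operatorname{cap}_{s,p,\omega,R}(E,E_t\cap E_{4t/\kappa,R},G)\le C\,\operatorname{cap}_{s,p,\omega}(E,E_t,G),$$ where $C=\kappa^{-np}\,C(n,p,[\omega]_{A_p})$, with $C(n,p,[\omega]_{A_p})$ a positive constant depending only on $n$, $p$ and $[\omega]_{A_p}$.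
   Context: A weight in $\mathbb{R}^n$ is a function $\omega\in L^1_{\mathrm{loc}}(\mathbb{R}^n)$ with $\omega>0$ almost everywhere. For $1<p<\infty$, it is an $A_p$ weight if there is $A>0$ such that $\big(\frac1{|Q|}\int_Q\omega\,dx\big)\big(\frac1{|Q|}\int_Q\omega^{-1/(p-1)}\,dx\big)^{p-1}\le A$ for every cube $Q\subset\mathbb{R}^n$; the infimum of such $A$ is $[\omega]_{A_p}$. A set $E\subset\mathbb{R}^n$ is $\kappa$-porous ($0<\kappa<1$) if for each $x\in E$ and every $0<r<\operatorname{diam}(E)$ there exists $y\in\mathbb{R}^n$ such that $B(y,\kappa r)\subset B(x,r)\setminus E$, where $B(\cdot,\cdot)$ denotes open balls. For $t>0$: $E_{t,R}=\{x\in G: R(x)<t\}$ and $E_t=\{x\in G:\operatorname{dist}(x,E)<t\}$. $C_0(G)$ is the space of continuous functions on $G$ whose support (the closure in $\mathbb{R}^n$ of $\{x\in G: f(x)\ne0\}$) is a compact set contained in $G$. For a measurable $R:G\to\mathbb{R}$ and a compact set $E$ contained in an open set $H\subset G$, $$\operatorname{cap}_{s,p,\omega,R}(E,H,G)=\inf_\varphi\int_G\int_G\frac{|\varphi(x)-\varphi(y)|^p}{(|x-y|+|R(x)-R(y)|)^{sp}}\,\omega(x-y)\,dy\,dx,$$ where the infimum is over all real-valued $\varphi\in C_0(G)$ such that $\varphi(x)\ge1$ for every $x\in E$ and $\varphi(x)=0$ for every $x\in G\setminus H$. If $R(x)=0$ for every $x\in G$, this is abbreviated $\operatorname{cap}_{s,p,\omega}(E,H,G)$.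 *)

theory Defs
  imports "HOL-Analysis.Analysis"
begin

definition weight :: "(real ^ 'n \<Rightarrow> real) \<Rightarrow> bool" where
  "weight \<omega> \<longleftrightarrow>
     (\<forall>K. compact K \<longrightarrow> set_integrable lebesgue K \<omega>) \<and> (AE x in lebesgue. 0 < \<omega> x)"

text \<open>Cubes are non-degenerate and have their sides parallel to the coordinate axes.\<close>

definition cubes :: "(real ^ 'n) set set" where
  "cubes = {cbox a (a + (\<chi> i. l)) |a l. 0 < l}"

definition average :: "(real ^ 'n) set \<Rightarrow> (real ^ 'n \<Rightarrow> real) \<Rightarrow> real" where
  "average Q f = (1 / measure lebesgue Q) * (LINT x:Q|lebesgue. f x)"

text \<open>
  The Bochner integral of a non-integrable function is 0, so finiteness of the second integral,
  which is implicit in the inequality, has to be required. For the first one it is part of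
  being a weight.
\<close>

definition Ap_bound :: "real \<Rightarrow> (real ^ 'n \<Rightarrow> real) \<Rightarrow> real \<Rightarrow> bool" where
  "Ap_bound p \<omega> A \<longleftrightarrow> 0 < A \<and>
     (\<forall>Q\<in>cubes. set_integrable lebesgue Q (\<lambda>x. \<omega> x powr (- 1 / (p - 1))) \<and>
        average Q \<omega> * average Q (\<lambda>x. \<omega> x powr (- 1 / (p - 1))) powr (p - 1) \<le> A)"

definition Ap_weight :: "real \<Rightarrow> (real ^ 'n \<Rightarrow> real) \<Rightarrow> bool" where
  "Ap_weight p \<omega> \<longleftrightarrow> weight \<omega> \<and> (\<exists>A. Ap_bound p \<omega> A)"

definition Ap_const :: "real \<Rightarrow> (real ^ 'n \<Rightarrow> real) \<Rightarrow> real" where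
  "Ap_const p \<omega> = Inf {A. Ap_bound p \<omega> A}"

text \<open>
  The library's \<open>diameter\<close> is only meaningful for bounded sets; an unbounded set has
  infinite diameter, so that all radii are admitted.
\<close>

definition porous :: "real \<Rightarrow> (real ^ 'n) set \<Rightarrow> bool" where
  "porous \<kappa> E \<longleftrightarrow> 0 < \<kappa> \<and> \<kappa> < 1 \<and>
     (\<forall>x\<in>E. \<forall>r. 0 < r \<and> (bounded E \<longrightarrow> r < diameter E) \<longrightarrow>
        (\<exists>y. ball y (\<kappa> * r) \<subseteq> ball x r - E))"

definition dist_nbhd :: "(real ^ 'n) set \<Rightarrow> (real ^ 'n) set \<Rightarrow> real \<Rightarrow> (real ^ 'n) set" where
  "dist_nbhd G E t = {x \<in> G. infdist x E < t}"

definition sublevel :: "(real ^ 'n) set \<Rightarrow> (real ^ 'n \<Rightarrow> real) \<Rightarrow> real \<Rightarrow> (real ^ 'n) set" where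
  "sublevel G R t = {x \<in> G. R x < t}"

text \<open>
  Functions on \<open>G\<close> are represented by total functions whose values outside \<open>G\<close> are irrelevant.
\<close>

definition C0 :: "(real ^ 'n) set \<Rightarrow> (real ^ 'n \<Rightarrow> real) set" where
  "C0 G = {f. continuous_on G f \<and> compact (closure {x \<in> G. f x \<noteq> 0}) \<and>
              closure {x \<in> G. f x \<noteq> 0} \<subseteq> G}"

text \<open>
  The energy may be infinite and is therefore extended-real valued. On the diagonal
  the integrand is 0 because of the convention \<open>0 / 0 = 0\<close>.
\<close>

definition energy ::
  "real \<Rightarrow> real \<Rightarrow> (real ^ 'n \<Rightarrow> real) \<Rightarrow> (real ^ 'n \<Rightarrow> real) \<Rightarrow> (real ^ 'n) set \<Rightarrow>
     (real ^ 'n \<Rightarrow> real) \<Rightarrow> ennreal" where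
  "energy s p \<omega> R G \<phi> =
     (\<integral>\<^sup>+x\<in>G. (\<integral>\<^sup>+y\<in>G.
        ennreal (\<bar>\<phi> x - \<phi> y\<bar> powr p / (norm (x - y) + \<bar>R x - R y\<bar>) powr (s * p) * \<omega> (x - y))
        \<partial>lebesgue) \<partial>lebesgue)"

definition capR ::
  "real \<Rightarrow> real \<Rightarrow> (real ^ 'n \<Rightarrow> real) \<Rightarrow> (real ^ 'n \<Rightarrow> real) \<Rightarrow>
     (real ^ 'n) set \<Rightarrow> (real ^ 'n) set \<Rightarrow> (real ^ 'n) set \<Rightarrow> ennreal" where
  "capR s p \<omega> R E H G =
     (INF \<phi> \<in> {\<phi> \<in> C0 G. (\<forall>x\<in>E. 1 \<le> \<phi> x) \<and> (\<forall>x\<in>G - H. \<phi> x = 0)}. energy s p \<omega> R G \<phi>)"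

abbreviation cap ::
  "real \<Rightarrow> real \<Rightarrow> (real ^ 'n \<Rightarrow> real) \<Rightarrow>
     (real ^ 'n) set \<Rightarrow> (real ^ 'n) set \<Rightarrow> (real ^ 'n) set \<Rightarrow> ennreal" where
  "cap s p \<omega> E H G \<equiv> capR s p \<omega> (\<lambda>x. 0) E H G"

end

theory Submission
  imports Defs
begin

text \<open>
  Let \<open>L = t / \<kappa>\<close>. A competitor \<open>\<phi>\<close> for the right-hand side is turned into one for the left-hand side
  by multiplying it with a cutoff \<open>h(R)\<close>, where \<open>h\<close> is 1 up to \<open>3L\<close> and 0 from \<open>4L\<close> on. The Lipschitz
  bound for \<open>h\<close> and the term \<open>|R x - R y|\<close> in the kernel bound the additional energy by integrals of
  \<open>|\<phi> y|\<^sup>p \<omega>(x - y) / (|x - y| + L)\<^bsup>sp\<^esup>\<close> over points \<open>x\<close> with \<open>infdist x E < t\<close> and \<open>R x > 3L\<close>. Near such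
  an \<open>x\<close>, porosity gives a ball of radius \<open>t\<close> in \<open>G\<close> on which \<open>\<phi>\<close> vanishes. By the \<open>A\<^sub>p\<close> condition a
  cube of size \<open>L\<close> around \<open>x\<close> has \<open>\<omega>(\<cdot> - y)\<close>-mass at most \<open>C \<kappa>\<^bsup>-np\<^esup>\<close> times that of the ball, and the
  interaction of \<open>y\<close> with the ball is part of the energy of \<open>\<phi>\<close>.
\<close>

section \<open>Muckenhoupt weights and strong doubling\<close>

text \<open>Local integrability gives measurability only after multiplication with the indicator of
  a ball. At each point these truncations are eventually equal to \<open>\<omega>\<close>, so
  \<open>\<omega>\<close> is their limit.\<close>

lemma weight_measurable:
  fixes \<omega> :: "real ^ 'n \<Rightarrow> real"
  assumes "weight \<omega>"
  shows "\<omega> \<in> borel_measurable lebesgue"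
proof (rule borel_measurable_LIMSEQ_real)
  fix k :: nat
  show "(\<lambda>x. indicat_real (cball 0 (real k)) x *\<^sub>R \<omega> x) \<in> borel_measurable lebesgue"
    using assms unfolding weight_def set_integrable_def
    by (intro borel_measurable_integrable) auto
next
  fix x :: "real ^ 'n"
  obtain m :: nat where m: "norm x \<le> real m" using real_arch_simple by blast
  show "(\<lambda>k. indicat_real (cball 0 (real k)) x *\<^sub>R \<omega> x) \<longlonglongrightarrow> \<omega> x"
    by (rule tendsto_eventually)
       (use m in \<open>auto simp: eventually_sequentially indicator_def intro!: exI[of _ m]\<close>)
qed

text \<open>Hoelder's inequality on \<open>S\<close> with exponents \<open>p\<close> and
  \<open>p / (p - 1)\<close>, raised to the power \<open>p\<close>. It bounds the mass of
  \<open>\<omega>\<close> on a subset of a cube from below by the dual integral, the other factor in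
  the A_p condition.\<close>

lemma measure_powr_le_dual_integrals:
  fixes \<omega> :: "'a \<Rightarrow> real"
  assumes p: "1 < p" and S: "S \<in> sets M" "emeasure M S < \<infinity>"
    and pos: "AE x in M. 0 < \<omega> x"
    and i1: "set_integrable M S \<omega>" 
    and i2: "set_integrable M S (\<lambda>x. \<omega> x powr (- 1 / (p - 1)))"
  shows "measure M S powr p \<le>
    (LINT x:S|M. \<omega> x) * (LINT x:S|M. \<omega> x powr (- 1 / (p - 1))) powr (p - 1)"
proof (cases "measure M S = 0")
  case True
  have "0 \<le> (LINT x:S|M. \<omega> x)"
    unfolding set_lebesgue_integral_def
    by (rule integral_nonneg_AE) (use pos in \<open>auto simp: indicator_def\<close>)
  then show ?thesis using True p by simp
next
  case False
  define a where "a = (LINT x:S|M. \<omega> x)"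
  define \<sigma> where "\<sigma> = (LINT x:S|M. \<omega> x powr (- 1 / (p - 1)))"
  have m0: "measure M S > 0" using False by (simp add: less_le measure_nonneg)
  \<comment> \<open>A set of positive measure is not null, so an a.e. positive function has a
    strictly positive integral over it. Both integrals occur in the quotient
    \<open>\<sigma> / a\<close> below.\<close>
  have nz: "\<not> (AE x in M. x \<notin> S)"
    using m0 S by (auto simp: AE_iff_measurable[OF S(1)] AE_iff_null_sets[symmetric] null_sets_def measure_def)
  have "0 < a" if "a = (LINT x:S|M. f x)" "set_integrable M S f" "AE x in M. 0 < f x" for a and f :: "'a \<Rightarrow> real"
  proof -
    have nn: "AE x in M. 0 \<le> indicat_real S x *\<^sub>R f x"
      using that(3) by eventually_elim (auto simp: indicator_def)
    have "a \<noteq> 0"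
    proof
      assume "a = 0"
      then have "AE x in M. indicat_real S x *\<^sub>R f x = 0"
        using integral_nonneg_eq_0_iff_AE[OF that(2)[unfolded set_integrable_def] nn] that(1)
        by (simp add: set_lebesgue_integral_def)
      with that(3) have "AE x in M. x \<notin> S" by eventually_elim (auto simp: indicator_def split: if_splits)
      with nz show False by simp
    qed
    moreover have "a \<ge> 0"
      unfolding that(1) set_lebesgue_integral_def using nn by (rule integral_nonneg_AE)
    ultimately show ?thesis by simp
  qed note intpos = this
  have a0: "a > 0" by (rule intpos[OF a_def i1 pos])
  have s0: "\<sigma> > 0" by (rule intpos[OF \<sigma>_def i2]) (use pos in \<open>eventually_elim, simp\<close>)
  \<comment> \<open>Hoelder's inequality for \<open>\<omega>\<^bsup>1/p\<^esup> \<omega>\<^bsup>-1/p\<^esup> = 1\<close>: this \<open>c\<close> makes the two integrals in Young's inequality equal.\<close>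
  define c where "c = (\<sigma> / a) powr ((p - 1) / p)"
  have c0: "c > 0" using a0 s0 by (simp add: c_def)
  define d where "d = c powr (- 1 / (p - 1))"
  \<comment> \<open>Weighted Young for \<open>c * v\<close> and
    \<open>(c * v) powr (- 1 / (p - 1))\<close>: with weights \<open>1 / p\<close> and
    \<open>1 - 1 / p\<close> the exponents of the geometric mean cancel, which leaves 1. With
    \<open>v = \<omega> x\<close>, integration over \<open>S\<close> bounds the measure of
    \<open>S\<close>.\<close>
  have young: "1 \<le> (c / p) * v + ((1 - 1 / p) * d) * v powr (- 1 / (p - 1))" if "v > 0" for v :: real
  proof -
    have "(c * v) powr (1 / p) * ((c * v) powr (- 1 / (p - 1))) powr (1 - 1 / p)
       \<le> (1 / p) * (c * v) + (1 - 1 / p) * (c * v) powr (- 1 / (p - 1))"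
      by (rule Youngs_inequality_0) (use p c0 that in auto)
    moreover have "(- 1 / (p - 1)) * (1 - 1 / p) = - (1 / p)" using p by (simp add: divide_simps)
    then have "(c * v) powr (1 / p) * ((c * v) powr (- 1 / (p - 1))) powr (1 - 1 / p) = 1"
      using c0 that by (simp add: powr_powr flip: powr_add)
    ultimately show ?thesis using c0 that by (simp add: d_def powr_mult)
  qed
  have ii: "set_integrable M S (\<lambda>x. (c / p) * \<omega> x)"
     "set_integrable M S (\<lambda>x. ((1 - 1 / p) * d) * \<omega> x powr (- 1 / (p - 1)))"
    using i1 i2 by (auto intro!: set_integrable_mult_right)
  have "measure M S = (LINT x:S|M. 1)"
    using S by (simp add: set_lebesgue_integral_def)
  also have "\<dots> \<le> (LINT x:S|M. (c / p) * \<omega> x + ((1 - 1 / p) * d) * \<omega> x powr (- 1 / (p - 1)))"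
  proof (rule set_integral_mono_AE)
    show "set_integrable M S (\<lambda>x. 1::real)" using S by (simp add: set_integrable_def)
    show "set_integrable M S (\<lambda>x. (c / p) * \<omega> x + ((1 - 1 / p) * d) * \<omega> x powr (- 1 / (p - 1)))"
      using ii by (rule set_integral_add)
    show "AE x\<in>S in M. 1 \<le> (c / p) * \<omega> x + ((1 - 1 / p) * d) * \<omega> x powr (- 1 / (p - 1))"
      using pos by eventually_elim (use young in auto)
  qed
  also have "\<dots> = (c / p) * a + ((1 - 1 / p) * d) * \<sigma>"
    by (subst set_integral_add(2)[OF ii]) (simp add: a_def \<sigma>_def)
  also have "c * a = a powr (1 / p) * \<sigma> powr ((p - 1) / p)"
  proof -
    have "a = a powr (1/p) * a powr ((p - 1) / p)" using a0 p by (simp flip: powr_add add: divide_simps)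
    then show ?thesis using a0 s0 by (simp add: c_def powr_divide field_simps)
  qed
  then have "(c / p) * a = (1 / p) * (a powr (1 / p) * \<sigma> powr ((p - 1) / p))"
    by (metis (no_types, opaque_lifting) mult.assoc mult.commute mult_1 times_divide_eq_left)
  also have "d * \<sigma> = a powr (1 / p) * \<sigma> powr ((p - 1) / p)"
  proof -
    have "\<sigma> = \<sigma> powr (1/p) * \<sigma> powr ((p - 1) / p)" using s0 p by (simp flip: powr_add add: divide_simps)
    have "((p - 1) / p) * (- 1 / (p - 1)) = - (1 / p)" using p by (simp add: divide_simps)
    then have "d = (\<sigma> / a) powr (- (1 / p))" unfolding d_def c_def powr_powr by simp
    then have "d * \<sigma> powr (1 / p) = a powr (1 / p)" using a0 s0 by (simp add: powr_divide powr_minus field_simps)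
    with \<open>\<sigma> = \<sigma> powr (1/p) * \<sigma> powr ((p - 1) / p)\<close> show ?thesis by (metis mult.assoc)
  qed
  then have "((1 - 1 / p) * d) * \<sigma> = (1 - 1 / p) * (a powr (1 / p) * \<sigma> powr ((p - 1) / p))"
    by (simp add: mult.assoc)
  finally have "measure M S \<le> a powr (1 / p) * \<sigma> powr ((p - 1) / p)"
    by (simp add: algebra_simps)
  then have "measure M S powr p \<le> (a powr (1 / p) * \<sigma> powr ((p - 1) / p)) powr p"
    using p by (intro powr_mono2) auto
  also have "\<dots> = a * \<sigma> powr (p - 1)"
    using a0 s0 p by (simp add: powr_mult powr_powr)
  finally show ?thesis by (simp add: a_def \<sigma>_def)
qed

text \<open>The closed ball of the maximum norm, with half-side \<open>r\<close>. Parametrizing by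
  the centre makes \<open>x \<in> cube u r\<close> symmetric in \<open>x\<close> and
  \<open>u\<close>, which the averaging over centres relies on.\<close>

definition cube :: "real ^ 'n \<Rightarrow> real \<Rightarrow> (real ^ 'n) set" where
  "cube u r = cbox (u - (\<chi> i. r)) (u + (\<chi> i. r))"

lemma mem_cube: "x \<in> cube u r \<longleftrightarrow> (\<forall>i. \<bar>x $ i - u $ i\<bar> \<le> r)"
  by (auto simp: cube_def interval_cart abs_le_iff diff_le_eq le_diff_eq add.commute)

lemma cube_borel [measurable]: "cube u r \<in> sets borel"
  by (simp add: cube_def)

lemma cube_in_cubes: "0 < r \<Longrightarrow> cube u r \<in> cubes"
proof -
  assume "0 < r"
  moreover have "u + (\<chi> i. r) = u - (\<chi> i. r) + (\<chi> i. 2 * r)" by (simp add: vec_eq_iff)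
  ultimately show ?thesis
    unfolding cubes_def cube_def mem_Collect_eq
    by (intro exI[of _ "u - (\<chi> i. r)"] exI[of _ "2 * r"] conjI arg_cong2[where f = cbox]) simp_all
qed

lemma measure_cube: "0 \<le> r \<Longrightarrow> measure lborel (cube (u :: real ^ 'n) r) = (2 * r) ^ CARD('n)"
  unfolding cube_def by (subst content_cbox_cart) (auto simp: interval_cart intro!: exI[of _ u])

lemma dist_le_of_mem_cube:
  assumes "x \<in> cube (u :: real ^ 'n) r" shows "norm (x - u) \<le> real CARD('n) * r"
proof -
  have "norm (x - u) \<le> (\<Sum>i\<in>UNIV. \<bar>(x - u) $ i\<bar>)" by (rule norm_le_l1_cart)
  also have "\<dots> \<le> (\<Sum>i\<in>(UNIV::'n set). r)" by (rule sum_mono) (use assms in \<open>simp add: mem_cube\<close>)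
  finally show ?thesis by simp
qed

text \<open>This is \<open>(|S| / |Q|)^p \<le> A * w(S) / w(Q)\<close> with the denominators
  cleared, so that it makes sense for extended nonnegative masses without division.\<close>

definition strong_doubling :: "real \<Rightarrow> real \<Rightarrow> (real ^ 'n \<Rightarrow> ennreal) \<Rightarrow> bool" where
  "strong_doubling p A w \<longleftrightarrow> (\<forall>u r S. 0 < r \<longrightarrow> S \<in> sets borel \<longrightarrow> S \<subseteq> cube u r \<longrightarrow>
     ennreal (measure lborel S powr p) * (\<integral>\<^sup>+x\<in>cube u r. w x \<partial>lborel)
     \<le> ennreal (A * measure lborel (cube u r) powr p) * (\<integral>\<^sup>+x\<in>S. w x \<partial>lborel))"

text \<open>Hoelder's inequality on \<open>S\<close> is multiplied by the mass of the whole cube.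
  Enlarging \<open>S\<close> to the cube in the dual integral only, the product of the two cube
  integrals appears, and the A_p bound controls it.\<close>

lemma Ap_bound_imp_strong_doubling:
  fixes \<omega> :: "real ^ 'n \<Rightarrow> real"
  assumes p: "1 < p" and wt: "weight \<omega>" and Ap: "Ap_bound p \<omega> A"
  shows "strong_doubling p A (\<lambda>x. ennreal (\<omega> x))"
  unfolding strong_doubling_def
proof (intro allI impI)
  fix u :: "real ^ 'n" and r :: real and S
  assume r: "0 < r" and S: "S \<in> sets borel" "S \<subseteq> cube u r"
  let ?Q = "cube u r"
  let ?v = "\<lambda>x. \<omega> x powr (- 1 / (p - 1))"
  have pos: "AE x in lebesgue. 0 < \<omega> x" using wt by (simp add: weight_def)
  have QQ: "?Q \<in> cubes" using r by (rule cube_in_cubes)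
  have i2: "set_integrable lebesgue ?Q ?v"
   and av: "average ?Q \<omega> * average ?Q ?v powr (p - 1) \<le> A"
    using Ap QQ by (auto simp: Ap_bound_def)
  have i1: "set_integrable lebesgue ?Q \<omega>" using wt by (simp add: weight_def cube_def)
  have Sl: "S \<in> sets lebesgue" using S by simp
  \<comment> \<open>The bridge from the Bochner integrals over \<open>lebesgue\<close> in
    \<open>Ap_bound\<close> to the nonnegative integrals over \<open>lborel\<close> in
    \<open>strong_doubling\<close>.\<close>
  have nn: "(\<integral>\<^sup>+x\<in>T. ennreal (\<omega> x) \<partial>lborel) = ennreal (LINT x:T|lebesgue. \<omega> x)"
     "0 \<le> (LINT x:T|lebesgue. \<omega> x)"
    if "T \<in> sets lebesgue" "T \<subseteq> ?Q" for T
  proof -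
    have "set_integrable lebesgue T \<omega>" using set_integrable_subset[OF i1 that] .
    moreover have ae: "AE x in lebesgue. 0 \<le> indicat_real T x *\<^sub>R \<omega> x"
      using pos by eventually_elim (auto simp: indicator_def)
    ultimately have "(\<integral>\<^sup>+x. ennreal (indicat_real T x *\<^sub>R \<omega> x) \<partial>lebesgue) = ennreal (LINT x:T|lebesgue. \<omega> x)"
      unfolding set_integrable_def set_lebesgue_integral_def by (rule nn_integral_eq_integral)
    then show "(\<integral>\<^sup>+x\<in>T. ennreal (\<omega> x) \<partial>lborel) = ennreal (LINT x:T|lebesgue. \<omega> x)"
      by (simp add: nn_integral_completion nn_integral_set_ennreal mult.commute)
    show "0 \<le> (LINT x:T|lebesgue. \<omega> x)"
      unfolding set_lebesgue_integral_def using ae by (rule integral_nonneg_AE)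
  qed
  have Q0: "measure lebesgue ?Q > 0" using r measure_cube[of r u] by (simp add: measure_completion)
  have fin: "emeasure lebesgue S < \<infinity>"
  proof -
    have "emeasure lebesgue S \<le> emeasure lebesgue ?Q" by (rule emeasure_mono) (use S in auto)
    also have "\<dots> < \<infinity>" by (simp add: cube_def emeasure_lborel_cbox_finite[unfolded infinity_ennreal_def])
    finally show ?thesis .
  qed
  let ?a = "LINT x:S|lebesgue. \<omega> x" and ?s = "LINT x:S|lebesgue. ?v x"
  let ?W = "LINT x:?Q|lebesgue. \<omega> x" and ?V = "LINT x:?Q|lebesgue. ?v x"
  have "measure lebesgue S powr p \<le> ?a * ?s powr (p - 1)"
    by (rule measure_powr_le_dual_integrals[OF p Sl fin pos])
       (use set_integrable_subset[OF i1 Sl] set_integrable_subset[OF i2 Sl] S in auto)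
  also have "?s \<le> ?V"
    unfolding set_lebesgue_integral_def
    by (rule integral_mono) (use set_integrable_subset[OF i2 Sl] S i2 in \<open>auto simp: set_integrable_def indicator_def\<close>)
  then have "?a * ?s powr (p - 1) \<le> ?a * ?V powr (p - 1)"
    using nn(2)[OF Sl S(2)] p
    by (intro mult_left_mono powr_mono2) (auto simp: set_lebesgue_integral_def intro!: integral_nonneg_AE)
  finally have 1: "measure lebesgue S powr p \<le> ?a * ?V powr (p - 1)" .
  have V0: "?V \<ge> 0" by (auto simp: set_lebesgue_integral_def intro!: integral_nonneg_AE)
  have 2: "?W * ?V powr (p - 1) \<le> A * measure lebesgue ?Q powr p"
  proof -
    have "average ?Q \<omega> * average ?Q ?v powr (p - 1) =
       (?W * ?V powr (p - 1)) / (measure lebesgue ?Q * measure lebesgue ?Q powr (p - 1))"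
      using Q0 V0 by (simp add: average_def powr_divide)
    also have "measure lebesgue ?Q * measure lebesgue ?Q powr (p - 1) = measure lebesgue ?Q powr p"
      using Q0 powr_add[of "measure lebesgue ?Q" 1 "p - 1"] by simp
    finally show ?thesis using av Q0 by (simp add: pos_divide_le_eq)
  qed
  have "measure lebesgue S powr p * ?W \<le> ?a * ?V powr (p - 1) * ?W"
    using 1 nn(2)[of ?Q] by (intro mult_right_mono) auto
  also have "\<dots> = ?a * (?W * ?V powr (p - 1))" by simp
  also have "\<dots> \<le> ?a * (A * measure lebesgue ?Q powr p)"
    using 2 nn(2)[OF Sl S(2)] by (intro mult_left_mono) auto
  finally have "measure lebesgue S powr p * ?W \<le> (A * measure lebesgue ?Q powr p) * ?a"
    by (simp add: mult_ac)
  moreover have "A > 0" using Ap by (simp add: Ap_bound_def)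
  ultimately show "ennreal (measure lborel S powr p) * (\<integral>\<^sup>+x\<in>?Q. ennreal (\<omega> x) \<partial>lborel)
     \<le> ennreal (A * measure lborel ?Q powr p) * (\<integral>\<^sup>+x\<in>S. ennreal (\<omega> x) \<partial>lborel)"
    using nn(2)[OF Sl S(2)] nn(2)[of ?Q] S
    by (simp add: nn(1)[OF Sl S(2)] nn(1)[of ?Q] measure_completion flip: ennreal_mult)
qed

lemma strong_doubling_cong_AE:
  assumes "strong_doubling p A v" "AE x in lborel. v x = w x"
  shows "strong_doubling p A w"
proof -
  have "(\<integral>\<^sup>+x\<in>T. v x \<partial>lborel) = (\<integral>\<^sup>+x\<in>T. w x \<partial>lborel)" for T
    by (rule nn_integral_cong_AE) (use assms(2) in auto)
  then show ?thesis using assms(1) by (simp add: strong_doubling_def)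
qed

section \<open>Invariance of strong doubling under translation and reflection\<close>

lemma lborel_distr_reflect:
  "distr lborel borel (\<lambda>x. y - x) = (lborel :: 'a::euclidean_space measure)"
  by (subst lborel_affine[of "- 1" y]) (simp_all add: density_1)

lemma lborel_distr_minus:
  "distr lborel borel (\<lambda>x. x - y) = (lborel :: 'a::euclidean_space measure)"
proof -
  have "(+) (- y) = (\<lambda>x. x - y)" by auto
  with lborel_distr_plus[of "- y"] show ?thesis by simp
qed

text \<open>Change of variables along the measure-preserving map \<open>T\<close>. Preimages under
  the left inverse \<open>T'\<close> stand in for images under \<open>T\<close>, so that their
  measurability is immediate.\<close>

lemma strong_doubling_comp:
  fixes w :: "real ^ 'n \<Rightarrow> ennreal" and T T' :: "real ^ 'n \<Rightarrow> real ^ 'n"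
  assumes w [measurable]: "w \<in> borel_measurable borel"
    and [measurable]: "T \<in> borel_measurable borel" "T' \<in> borel_measurable borel"
    and inv: "\<And>x. T' (T x) = x" and distr: "distr lborel borel T = lborel"
    and cb: "\<And>u r. T' -` cube u r = cube (T u) r"
    and sd: "strong_doubling p A w"
  shows "strong_doubling p A (\<lambda>x. w (T x))"
  unfolding strong_doubling_def
proof (intro allI impI)
  fix u :: "real ^ 'n" and r :: real and S assume r: "0 < r" and S [measurable]: "S \<in> sets borel" and sub: "S \<subseteq> cube u r"
  have int: "(\<integral>\<^sup>+x\<in>X. w (T x) \<partial>lborel) = (\<integral>\<^sup>+x\<in>T' -` X. w x \<partial>lborel)"
    if [measurable]: "X \<in> sets borel" for X
  proof -
    have "(\<integral>\<^sup>+x\<in>T' -` X. w x \<partial>lborel) = (\<integral>\<^sup>+x. w x * indicator X (T' x) \<partial>distr lborel borel T)"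
      unfolding distr by (simp add: indicator_def vimage_def)
    also have "\<dots> = (\<integral>\<^sup>+x\<in>X. w (T x) \<partial>lborel)" by (subst nn_integral_distr) (auto simp: inv)
    finally show ?thesis by simp
  qed
  have mT [measurable]: "T' -` X \<in> sets borel" if "X \<in> sets borel" for X
    using measurable_sets_borel[OF _ that, of T'] by simp
  have meas: "measure lborel (T' -` X) = measure lborel X" if [measurable]: "X \<in> sets borel" for X
  proof -
    have "measure (distr lborel borel T) (T' -` X) = measure lborel (T -` (T' -` X) \<inter> space lborel)"
      by (rule measure_distr) (use that in auto)
    then show ?thesis unfolding distr by (simp add: vimage_def inv)
  qed
  have "ennreal (measure lborel (T' -` S) powr p) * (\<integral>\<^sup>+x\<in>cube (T u) r. w x \<partial>lborel)
     \<le> ennreal (A * measure lborel (cube (T u) r) powr p) * (\<integral>\<^sup>+x\<in>T' -` S. w x \<partial>lborel)"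
    using sd r mT[OF S] vimage_mono[OF sub, of T'] unfolding cb strong_doubling_def by blast
  then show "ennreal (measure lborel S powr p) * (\<integral>\<^sup>+x\<in>cube u r. w (T x) \<partial>lborel)
     \<le> ennreal (A * measure lborel (cube u r) powr p) * (\<integral>\<^sup>+x\<in>S. w (T x) \<partial>lborel)"
    using meas[of S] meas[of "cube u r"] int[of S] int[of "cube u r"] by (simp add: cb)
qed

text \<open>For \<open>\<omega> (x - y)\<close> as a function of \<open>x\<close>; the reflected
  version serves for it as a function of \<open>y\<close>. Both are wanted because a weight need not
  be even.\<close>

lemma strong_doubling_translate:
  assumes "w \<in> borel_measurable borel" "strong_doubling p A w"
  shows "strong_doubling p A (\<lambda>x. w (x - y))"
  by (rule strong_doubling_comp[where T' = "\<lambda>x. x + y", OF assms(1) _ _ _ lborel_distr_minus _ assms(2)])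
     (auto simp: set_eq_iff mem_cube algebra_simps)

lemma strong_doubling_reflect:
  assumes "w \<in> borel_measurable borel" "strong_doubling p A w"
  shows "strong_doubling p A (\<lambda>x. w (y - x))"
  by (rule strong_doubling_comp[where T' = "\<lambda>x. y - x", OF assms(1) _ _ _ lborel_distr_reflect _ assms(2)])
     (auto simp: set_eq_iff mem_cube algebra_simps abs_minus_commute)

section \<open>Comparison of kernel integrals over a set and over its holes\<close>

lemma cube_sym: "x \<in> cube u r \<Longrightarrow> u \<in> cube x r"
  by (simp add: mem_cube abs_minus_commute)

lemma cube_trans:
  assumes "z \<in> cube x a" "x \<in> cube u b" "a + b \<le> c"
  shows "z \<in> cube u c"
  unfolding mem_cube
proof
  fix i
  have "\<bar>z $ i - x $ i\<bar> \<le> a" "\<bar>x $ i - u $ i\<bar> \<le> b" using assms by (simp_all add: mem_cube)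
  then show "\<bar>z $ i - u $ i\<bar> \<le> c" using assms(3) by linarith
qed

text \<open>Tonelli: by symmetry, the centres \<open>u\<close> whose cube contains a given
  \<open>x\<close> form \<open>cube x r\<close>, so every point is counted with the same
  weight.\<close>

lemma nn_integral_cube_average:
  fixes g :: "real ^ 'n \<Rightarrow> ennreal"
  assumes [measurable]: "g \<in> borel_measurable borel" and r: "0 \<le> r"
  shows "(\<integral>\<^sup>+u. (\<integral>\<^sup>+x\<in>cube u r. g x \<partial>lborel) \<partial>lborel) = ennreal ((2 * r) ^ CARD('n)) * (\<integral>\<^sup>+x. g x \<partial>lborel)"
proof -
  define D where "D = {q :: (real ^ 'n) \<times> (real ^ 'n). \<forall>i. \<bar>fst q $ i - snd q $ i\<bar> \<le> r}"
  have "closed D"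
    unfolding D_def by (intro closed_Collect_all closed_Collect_le continuous_intros)
  then have "D \<in> sets borel" by (rule borel_closed)
  then have [measurable]: "D \<in> sets (borel \<Otimes>\<^sub>M borel)" unfolding borel_prod .
  have ind: "indicator (cube u r) x = (indicator D (u, x) :: ennreal)"
    "indicator D (u, x) = (indicator (cube x r) u :: ennreal)" for u x
    by (auto simp: indicator_def mem_cube D_def abs_minus_commute)
  have "(\<integral>\<^sup>+u. (\<integral>\<^sup>+x\<in>cube u r. g x \<partial>lborel) \<partial>lborel)
      = (\<integral>\<^sup>+u. (\<integral>\<^sup>+x. g x * indicator D (u, x) \<partial>lborel) \<partial>lborel)"
    by (simp add: ind(1))
  also have "\<dots> = (\<integral>\<^sup>+x. (\<integral>\<^sup>+u. g x * indicator D (u, x) \<partial>lborel) \<partial>lborel)"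
    by (rule lborel_pair.Fubini') simp
  also have "\<dots> = (\<integral>\<^sup>+x. g x * emeasure lborel (cube x r) \<partial>lborel)"
    by (simp add: ind(2) nn_integral_cmult)
  also have "\<dots> = (\<integral>\<^sup>+x. ennreal ((2 * r) ^ CARD('n)) * g x \<partial>lborel)"
    using measure_cube[OF r, where 'n = 'n]
    by (subst emeasure_eq_ennreal_measure)
       (auto simp: cube_def emeasure_lborel_cbox_finite[unfolded infinity_ennreal_def] less_top mult.commute)
  also have "\<dots> = ennreal ((2 * r) ^ CARD('n)) * (\<integral>\<^sup>+x. g x \<partial>lborel)"
    by (rule nn_integral_cmult) simp
  finally show ?thesis .
qed

text \<open>
  Inside \<open>cube u L\<close> the estimate is strong doubling, as a cube that meets \<open>A\<close> has a hole nearby;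
  averaging over all centres \<open>u\<close> replaces a covering argument with bounded overlap.
\<close>

lemma nn_integral_le_of_holes:
  fixes v k1 k2 :: "real ^ 'n \<Rightarrow> ennreal" and A Z :: "(real ^ 'n) set"
  assumes [measurable]: "v \<in> borel_measurable borel" "k1 \<in> borel_measurable borel" "k2 \<in> borel_measurable borel"
      "A \<in> sets borel" "Z \<in> sets borel"
    and t: "0 < t" and L: "0 < L" and K: "0 \<le> K" and B: "0 \<le> B" and p: "0 < p"
    and sd: "strong_doubling p K v"
    and ker: "\<And>x z. z \<in> Z \<Longrightarrow> z \<in> cube x (5 * L) \<Longrightarrow> k1 x \<le> ennreal B * k2 z"
    and hole: "\<And>x. x \<in> A \<Longrightarrow> \<exists>b. ball b t \<subseteq> Z \<inter> cube x (3 * L)"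
  shows "(\<integral>\<^sup>+x\<in>A. k1 x * v x \<partial>lborel) \<le>
    ennreal (4 ^ CARD('n) * B * K * ((8 * L / t) ^ CARD('n) / unit_ball_vol CARD('n)) powr p) *
      (\<integral>\<^sup>+z\<in>Z. k2 z * v z \<partial>lborel)"
proof -
  let ?n = "CARD('n)"
  define \<rho> where "\<rho> = ((8 * L / t) ^ ?n / unit_ball_vol ?n) powr p"
  have \<rho>0: "\<rho> \<ge> 0" by (simp add: \<rho>_def)
  \<comment> \<open>The factor 4 is 1 + 3: a point of \<open>A\<close> in \<open>cube u L\<close>
    has its hole within \<open>3 * L\<close> of itself, hence inside
    \<open>cube u (4 * L)\<close>.\<close>
  have loc: "(\<integral>\<^sup>+x\<in>cube u L. (k1 x * v x) * indicator A x \<partial>lborel) \<le>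
     ennreal (B * K * \<rho>) * (\<integral>\<^sup>+z\<in>cube u (4 * L). (k2 z * v z) * indicator Z z \<partial>lborel)" for u
  proof (cases "A \<inter> cube u L = {}")
    case True
    then have "(\<lambda>x. (k1 x * v x) * indicator A x * indicator (cube u L) x) = (\<lambda>x. 0)"
      by (auto simp: indicator_def fun_eq_iff)
    then show ?thesis by simp
  next
    case False
    then obtain x b where x: "x \<in> A" "x \<in> cube u L" and b: "ball b t \<subseteq> Z \<inter> cube x (3 * L)"
      using hole by blast
    let ?S = "ball b t" and ?Q = "cube u (4 * L)"
    have [measurable]: "?S \<in> sets borel" by simp
    have SQ: "?S \<subseteq> ?Q"
    proof
      fix z assume "z \<in> ?S"
      then have "z \<in> cube x (3 * L)" using b by blast
      then show "z \<in> ?Q" using x(2) by (rule cube_trans) simp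
    qed
    \<comment> \<open>The kernel \<open>k1\<close> is replaced by its supremum over the small cube.
      Points of that cube and of the hole differ by at most \<open>L + 4 * L\<close> in each
      coordinate, whence the \<open>5 * L\<close> in \<open>ker\<close>.\<close>
    define M where "M = (SUP x\<in>cube u L. k1 x)"
    have MB: "M \<le> ennreal B * k2 z" if "z \<in> ?S" for z
      unfolding M_def
    proof (rule SUP_least)
      fix x assume "x \<in> cube u L"
      then have "u \<in> cube x L" by (rule cube_sym)
      moreover have "z \<in> cube u (4 * L)" using that SQ by blast
      ultimately have "z \<in> cube x (5 * L)" using cube_trans[of z u "4 * L" x L "5 * L"] by simp
      then show "k1 x \<le> ennreal B * k2 z" using ker b that by blast
    qed
    have mS: "measure lborel ?S = unit_ball_vol ?n * t ^ ?n" using t by (simp add: content_ball)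
    have mS0: "measure lborel ?S > 0" unfolding mS using t by simp
    have mQ: "measure lborel ?Q = (8 * L) ^ ?n" using L by (simp add: measure_cube)
    have \<rho>': "K * measure lborel ?Q powr p / measure lborel ?S powr p = K * \<rho>"
    proof -
      have "(8 * L / t) ^ ?n / unit_ball_vol ?n = (8 * L) ^ ?n / (unit_ball_vol ?n * t ^ ?n)"
        by (simp add: power_divide mult.commute)
      then show ?thesis using L t unfolding mS mQ \<rho>_def by (simp add: powr_divide)
    qed
    have "(\<integral>\<^sup>+x\<in>?Q. v x \<partial>lborel) =
       ennreal (1 / measure lborel ?S powr p) * (ennreal (measure lborel ?S powr p) * (\<integral>\<^sup>+x\<in>?Q. v x \<partial>lborel))"
      using mS0 by (simp flip: mult.assoc ennreal_mult)
    also have "\<dots> \<le> ennreal (1 / measure lborel ?S powr p) *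
        (ennreal (K * measure lborel ?Q powr p) * (\<integral>\<^sup>+x\<in>?S. v x \<partial>lborel))"
      using sd SQ L unfolding strong_doubling_def by (intro mult_left_mono) auto
    also have "\<dots> = ennreal (K * \<rho>) * (\<integral>\<^sup>+x\<in>?S. v x \<partial>lborel)"
      using K by (simp flip: mult.assoc ennreal_mult add: \<rho>')
    finally have W: "(\<integral>\<^sup>+x\<in>?Q. v x \<partial>lborel) \<le> ennreal (K * \<rho>) * (\<integral>\<^sup>+x\<in>?S. v x \<partial>lborel)" .
    have "(\<integral>\<^sup>+x\<in>cube u L. (k1 x * v x) * indicator A x \<partial>lborel) \<le> (\<integral>\<^sup>+x. M * (v x * indicator ?Q x) \<partial>lborel)"
    proof (rule nn_integral_mono)
      fix x
      show "(k1 x * v x) * indicator A x * indicator (cube u L) x \<le> M * (v x * indicator ?Q x)"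
      proof (cases "x \<in> cube u L")
        case True
        have "x \<in> ?Q" by (rule cube_trans[OF True, of u 0]) (use L in \<open>simp_all add: mem_cube\<close>)
        moreover have "k1 x \<le> M" unfolding M_def using True by (rule SUP_upper)
        ultimately show ?thesis by (auto simp: indicator_def intro: mult_right_mono)
      qed simp
    qed
    also have "\<dots> = M * (\<integral>\<^sup>+x\<in>?Q. v x \<partial>lborel)" by (rule nn_integral_cmult) simp
    also have "\<dots> \<le> M * (ennreal (K * \<rho>) * (\<integral>\<^sup>+x\<in>?S. v x \<partial>lborel))"
      using W by (rule mult_left_mono) simp
    also have "\<dots> = ennreal (K * \<rho>) * (\<integral>\<^sup>+x. M * (v x * indicator ?S x) \<partial>lborel)"
      by (subst nn_integral_cmult) (auto simp: mult_ac)
    also have "\<dots> \<le> ennreal (K * \<rho>) * (\<integral>\<^sup>+z. ennreal B * (k2 z * v z * indicator Z z * indicator ?Q z) \<partial>lborel)"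
    proof (intro mult_left_mono nn_integral_mono)
      fix z
      show "M * (v z * indicator ?S z) \<le> ennreal B * (k2 z * v z * indicator Z z * indicator ?Q z)"
      proof (cases "z \<in> ?S")
        case True
        then have "z \<in> Z" "z \<in> ?Q" using b SQ by auto
        then show ?thesis using True mult_right_mono[OF MB[OF True], of "v z"] by (simp add: mult.assoc)
      qed simp
    qed simp
    also have "\<dots> = ennreal (K * \<rho>) * (ennreal B * (\<integral>\<^sup>+z\<in>?Q. k2 z * v z * indicator Z z \<partial>lborel))"
      by (subst nn_integral_cmult) auto
    also have "\<dots> = ennreal (B * K * \<rho>) * (\<integral>\<^sup>+z\<in>?Q. k2 z * v z * indicator Z z \<partial>lborel)"
      using K B \<rho>0 by (simp add: ennreal_mult mult_ac)
    finally show ?thesis .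
  qed
  let ?I = "\<integral>\<^sup>+x\<in>A. k1 x * v x \<partial>lborel" and ?J = "\<integral>\<^sup>+z\<in>Z. k2 z * v z \<partial>lborel"
  \<comment> \<open>The local estimate is integrated over \<open>u\<close>. The small cubes
    contribute \<open>(2 * L) ^ ?n\<close> on the left, the large ones \<open>(8 * L) ^ ?n\<close>
    on the right; their quotient is the factor \<open>4 ^ ?n\<close>.\<close>
  have "ennreal ((2 * L) ^ ?n) * ?I = (\<integral>\<^sup>+u. (\<integral>\<^sup>+x\<in>cube u L. (k1 x * v x) * indicator A x \<partial>lborel) \<partial>lborel)"
    by (rule nn_integral_cube_average[symmetric]) (use L in auto)
  also have "\<dots> \<le> (\<integral>\<^sup>+u. (\<integral>\<^sup>+z\<in>cube u (4 * L). ennreal (B * K * \<rho>) * ((k2 z * v z) * indicator Z z) \<partial>lborel) \<partial>lborel)"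
  proof (rule nn_integral_mono)
    fix u
    have "(\<integral>\<^sup>+z\<in>cube u (4 * L). ennreal (B * K * \<rho>) * ((k2 z * v z) * indicator Z z) \<partial>lborel)
       = ennreal (B * K * \<rho>) * (\<integral>\<^sup>+z\<in>cube u (4 * L). (k2 z * v z) * indicator Z z \<partial>lborel)"
      by (subst nn_integral_cmult[symmetric]) (simp_all add: mult.assoc)
    then show "(\<integral>\<^sup>+x\<in>cube u L. (k1 x * v x) * indicator A x \<partial>lborel)
       \<le> (\<integral>\<^sup>+z\<in>cube u (4 * L). ennreal (B * K * \<rho>) * ((k2 z * v z) * indicator Z z) \<partial>lborel)"
      using loc[of u] by simp
  qed
  also have "\<dots> = ennreal ((2 * (4 * L)) ^ ?n) * (\<integral>\<^sup>+z. ennreal (B * K * \<rho>) * ((k2 z * v z) * indicator Z z) \<partial>lborel)"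
    by (rule nn_integral_cube_average) (use L in auto)
  also have "\<dots> = ennreal (B * K * \<rho>) * (ennreal ((2 * (4 * L)) ^ ?n) * ?J)"
    by (subst nn_integral_cmult) (auto simp: mult_ac)
  finally have "ennreal ((2 * L) ^ ?n) * ?I \<le> ennreal (B * K * \<rho>) * (ennreal ((2 * (4 * L)) ^ ?n) * ?J)" .
  then have "ennreal (1 / (2 * L) ^ ?n) * (ennreal ((2 * L) ^ ?n) * ?I) \<le>
     ennreal (1 / (2 * L) ^ ?n) * (ennreal (B * K * \<rho>) * (ennreal ((2 * (4 * L)) ^ ?n) * ?J))"
    by (rule mult_left_mono) simp
  moreover have "ennreal (1 / (2 * L) ^ ?n) * (ennreal ((2 * L) ^ ?n) * ?I) = ?I"
    using L by (simp flip: mult.assoc ennreal_mult)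
  moreover have "1 / (2 * L) ^ ?n * (B * K * \<rho>) * (2 * (4 * L)) ^ ?n = 4 ^ ?n * B * K * \<rho>"
  proof -
    have "(8::real) ^ ?n = 2 ^ ?n * 4 ^ ?n" by (simp flip: power_mult_distrib)
    then show ?thesis using L by (simp add: power_mult_distrib field_simps)
  qed
  then have "ennreal (1 / (2 * L) ^ ?n) * (ennreal (B * K * \<rho>) * (ennreal ((2 * (4 * L)) ^ ?n) * ?J))
      = ennreal (4 ^ ?n * B * K * \<rho>) * ?J"
    using L B K \<rho>0 by (simp flip: mult.assoc ennreal_mult)
  ultimately show ?thesis by (simp add: \<rho>_def)
qed

text \<open>Adding \<open>L\<close> makes the left kernel nearly constant at scale \<open>L\<close>:
  if \<open>z\<close> is in \<open>cube x (5 * L)\<close>, then \<open>norm (z - y)\<close> is at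
  most a dimensional multiple of \<open>norm (x - y) + L\<close>.\<close>

lemma nn_integral_kernel_le_of_holes:
  fixes v :: "real ^ 'n \<Rightarrow> ennreal" and A Z :: "(real ^ 'n) set"
  assumes v: "v \<in> borel_measurable borel" and AZ: "A \<in> sets borel" "Z \<in> sets borel"
    and t: "0 < t" and L: "0 < L" and K: "0 \<le> K" and q: "0 \<le> q" "q \<le> p" and p: "0 < p"
    and sd: "strong_doubling p K v"
    and y: "y \<notin> Z"
    and hole: "\<And>x. x \<in> A \<Longrightarrow> \<exists>b. ball b t \<subseteq> Z \<inter> cube x (3 * L)"
  shows "(\<integral>\<^sup>+x\<in>A. ennreal (1 / (norm (x - y) + L) powr q) * v x \<partial>lborel) \<le>
    ennreal (4 ^ CARD('n) * (5 * real CARD('n)) powr p * K *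
        ((8 * L / t) ^ CARD('n) / unit_ball_vol CARD('n)) powr p) *
      (\<integral>\<^sup>+z\<in>Z. ennreal (1 / norm (z - y) powr q) * v z \<partial>lborel)"
proof (rule nn_integral_le_of_holes[OF v _ _ AZ t L K _ p sd _ hole])
  fix x z assume z: "z \<in> Z" "z \<in> cube x (5 * L)"
  let ?N = "5 * real CARD('n)"
  have N1: "?N \<ge> 1" using zero_less_card_finite[where 'a = 'n] by linarith
  \<comment> \<open>At \<open>z = y\<close> the right-hand kernel would be 0 by the convention
    \<open>1 / 0 = 0\<close>, and the comparison would fail.\<close>
  have zy: "norm (z - y) > 0" using z y by auto
  have "norm (z - y) \<le> norm (x - y) + norm (z - x)" by norm
  also have "norm (z - x) \<le> ?N * L" using dist_le_of_mem_cube[OF z(2)] by simp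
  finally have "norm (z - y) \<le> ?N * (norm (x - y) + L)"
    using mult_right_mono[OF N1, of "norm (x - y)"] by (simp add: algebra_simps)
  then have "norm (z - y) powr q \<le> (?N * (norm (x - y) + L)) powr q"
    using q by (intro powr_mono2) auto
  also have "\<dots> = ?N powr q * (norm (x - y) + L) powr q"
    using L by (simp add: powr_mult)
  \<comment> \<open>Passing from \<open>q\<close> to \<open>p\<close> in the constant makes it
    independent of \<open>s\<close>, since \<open>q\<close> will be \<open>s * p\<close>.\<close>
  also have "\<dots> \<le> ?N powr p * (norm (x - y) + L) powr q"
    using q N1 by (intro mult_right_mono powr_mono) auto
  finally have "1 / (norm (x - y) + L) powr q \<le> ?N powr p * (1 / norm (z - y) powr q)"
    using zy L add_nonneg_pos[OF norm_ge_zero L, of "x - y"] by (simp add: field_simps)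
  then show "ennreal (1 / (norm (x - y) + L) powr q) \<le> ennreal (?N powr p) * ennreal (1 / norm (z - y) powr q)"
    by (simp flip: ennreal_mult)
qed auto

section \<open>The cutoff and the holes of a porous set\<close>

lemma add_powr_le:
  fixes a b p :: real
  assumes "0 \<le> a" "0 \<le> b" "0 \<le> p"
  shows "(a + b) powr p \<le> 2 powr p * (a powr p + b powr p)"
proof -
  have "(a + b) powr p \<le> (2 * max a b) powr p" using assms by (intro powr_mono2) auto
  also have "\<dots> = 2 powr p * max a b powr p" using assms by (simp add: powr_mult)
  also have "\<dots> \<le> 2 powr p * (a powr p + b powr p)"
    by (intro mult_left_mono) (auto simp: max_def)
  finally show ?thesis .
qed

section \<open>The cutoff in the values of \<open>R\<close>\<close>

definition cutoff :: "real \<Rightarrow> real \<Rightarrow> real" where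
  "cutoff L r = max 0 (min 1 (4 - r / L))"

lemma cutoff_bounds: "0 \<le> cutoff L r" "cutoff L r \<le> 1"
  by (auto simp: cutoff_def)

lemma cutoff_eq_1: "0 < L \<Longrightarrow> r \<le> 3 * L \<Longrightarrow> cutoff L r = 1"
  by (auto simp: cutoff_def field_simps)

lemma cutoff_eq_0: "0 < L \<Longrightarrow> 4 * L \<le> r \<Longrightarrow> cutoff L r = 0"
  by (auto simp: cutoff_def field_simps)

lemma cutoff_lipschitz:
  assumes "0 < L" shows "\<bar>cutoff L r - cutoff L r'\<bar> \<le> \<bar>r - r'\<bar> / L"
proof -
  have "\<bar>cutoff L r - cutoff L r'\<bar> \<le> \<bar>r / L - r' / L\<bar>" by (auto simp: cutoff_def)
  then show ?thesis using assms by (simp flip: diff_divide_distrib)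
qed

text \<open>This is where the term \<open>\<bar>R x - R y\<bar>\<close> of the kernel pays off. The
  difference \<open>c\<close> of the cutoffs satisfies \<open>c \<le> 1\<close> and
  \<open>c * L \<le> \<bar>r - r'\<bar>\<close>, hence
  \<open>c * (d + L) \<le> d + \<bar>r - r'\<bar>\<close>. Since \<open>s < 1\<close>, also
  \<open>c powr p \<le> c powr (s * p)\<close>.\<close>

lemma cutoff_kernel_le:
  assumes s: "0 < s" "s < 1" and p: "1 < p" and L: "0 < L" and d: "0 \<le> d"
  shows "\<bar>cutoff L r - cutoff L r'\<bar> powr p / (d + \<bar>r - r'\<bar>) powr (s * p) \<le> 1 / (d + L) powr (s * p)"
proof (cases "cutoff L r = cutoff L r'")
  case True
  then show ?thesis by simp
next
  case False
  let ?c = "\<bar>cutoff L r - cutoff L r'\<bar>"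
  have c: "0 < ?c" "?c \<le> 1" using False cutoff_bounds[of L r] cutoff_bounds[of L r'] by auto
  have D: "\<bar>r - r'\<bar> > 0" using False by auto
  have "?c * d \<le> d" using c d by (simp add: mult_left_le_one_le)
  moreover have "?c * L \<le> \<bar>r - r'\<bar>" using cutoff_lipschitz[OF L, of r r'] L by (simp add: field_simps)
  ultimately have le: "?c * (d + L) \<le> d + \<bar>r - r'\<bar>" by (simp add: distrib_left)
  have "?c powr p * (d + L) powr (s * p) \<le> ?c powr (s * p) * (d + L) powr (s * p)"
    using c s p by (intro mult_right_mono powr_mono') (auto simp: mult_le_cancel_right1)
  also have "\<dots> = (?c * (d + L)) powr (s * p)" using c d L by (simp add: powr_mult)
  also have "\<dots> \<le> (d + \<bar>r - r'\<bar>) powr (s * p)" using le c d L s p by (intro powr_mono2) auto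
  finally show ?thesis using d L D by (simp add: field_simps)
qed

text \<open>
  The bound on \<open>R\<close> enters only here: it keeps the hole inside \<open>G\<close>, where the energy sees it.
\<close>

lemma hole_exists:
  fixes E G :: "(real ^ 'n) set"
  assumes k: "0 < \<kappa>" "\<kappa> < 1" and E: "E \<noteq> {}" "compact E" and por: "porous \<kappa> E"
    and R: "\<forall>x\<in>G. R x \<le> infdist x (frontier G)"
    and t: "0 < t" "t < \<kappa> * diameter E / 4"
    and x: "x \<in> G" "infdist x E < t" "3 * (t / \<kappa>) < R x"
  shows "\<exists>b. ball b t \<subseteq> {z \<in> G. t \<le> infdist z E} \<inter> cube x (3 * (t / \<kappa>))"
proof -
  let ?L = "t / \<kappa>"
  have L: "0 < ?L" "t \<le> ?L" using k t by (auto simp: field_simps)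
  \<comment> \<open>A ball centred in \<open>G\<close> that leaves \<open>G\<close> meets the
    frontier by connectedness, which would force \<open>R x < 3 * ?L\<close>.\<close>
  have ballG: "ball x (3 * ?L) \<subseteq> G"
  proof (rule ccontr)
    assume "\<not> ball x (3 * ?L) \<subseteq> G"
    moreover have "x \<in> ball x (3 * ?L) \<inter> G" using x(1) L by simp
    ultimately have "ball x (3 * ?L) \<inter> frontier G \<noteq> {}"
      by (intro connected_Int_frontier connected_ball) blast+
    then obtain z where "z \<in> ball x (3 * ?L)" "z \<in> frontier G" by blast
    then have "infdist x (frontier G) < 3 * ?L" using infdist_le[of z "frontier G" x] by auto
    with R x show False by fastforce
  qed
  obtain e where e: "e \<in> E" "dist x e < t"
    using infdist_attains_inf[of E x] E x(2) compact_imp_closed by metis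
  \<comment> \<open>Porosity is used at the nearest point \<open>e\<close> with radius
    \<open>2 * ?L\<close>, admissible by the bound on \<open>t\<close>. The hole has radius
    \<open>2 * t\<close>, so its concentric half keeps distance \<open>t\<close> from
    \<open>E\<close>; it lies within \<open>3 * ?L\<close> of \<open>x\<close> because
    \<open>dist x e < t \<le> ?L\<close>.\<close>
  have "0 < 2 * ?L" "2 * ?L < diameter E" using L t k by (auto simp: field_simps)
  then have "\<exists>b. ball b (\<kappa> * (2 * ?L)) \<subseteq> ball e (2 * ?L) - E"
    using por e unfolding porous_def by blast
  then obtain b where b: "ball b (2 * t) \<subseteq> ball e (2 * ?L) - E" using k by auto
  have "ball b t \<subseteq> {z \<in> G. t \<le> infdist z E} \<inter> cube x (3 * ?L)"
  proof
    fix z assume z: "z \<in> ball b t"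
    then have "z \<in> ball b (2 * t)" using t by simp
    then have "z \<in> ball e (2 * ?L)" using b by blast
    then have zx: "dist x z < 3 * ?L" using e L dist_triangle[of x z e] by simp
    have "t \<le> infdist z E"
    proof (rule ccontr)
      assume "\<not> t \<le> infdist z E"
      then obtain e' where "e' \<in> E" "dist z e' < t"
        using infdist_attains_inf[of E z] E compact_imp_closed by (metis not_le)
      then have "e' \<in> ball b (2 * t)" using z dist_triangle[of b e' z] by simp
      with \<open>e' \<in> E\<close> b show False by blast
    qed
    moreover have "\<bar>z $ i - x $ i\<bar> \<le> 3 * ?L" for i
      using zx component_le_norm_cart[of "z - x" i] by (simp add: dist_norm norm_minus_commute)
    ultimately show "z \<in> {z \<in> G. t \<le> infdist z E} \<inter> cube x (3 * ?L)"
      using zx ballG by (auto simp: mem_cube)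
  qed
  then show ?thesis by blast
qed

text \<open>
  For Lebesgue measurable \<open>\<omega>\<close> the function \<open>\<omega> (x - y)\<close> need not be measurable for the (incomplete)
  product \<open>lebesgue \<Otimes>\<^sub>M lebesgue\<close>, so Tonelli is applied to a Borel representative.
\<close>

lemma weight_borel_representative:
  fixes \<omega> :: "real ^ 'n \<Rightarrow> real"
  assumes "weight \<omega>"
  obtains w :: "real ^ 'n \<Rightarrow> ennreal"
    where "w \<in> borel_measurable borel" "AE x in lborel. ennreal (\<omega> x) = w x"
proof -
  have "(\<lambda>x. ennreal (\<omega> x)) \<in> borel_measurable lebesgue"
    using weight_measurable[OF assms] by measurable
  then show ?thesis using completion_ex_borel_measurable[of _ lborel] that by (auto simp: measurable_lborel1)
qed

text \<open>Reflection and translation preserve null sets, so for every single \<open>x\<close> the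
  weight may be exchanged for its representative in the inner integral.\<close>

lemma energy_eq_lborel:
  fixes \<omega> R \<phi> :: "real ^ 'n \<Rightarrow> real"
  assumes AE: "AE x in lborel. ennreal (\<omega> x) = w x"
  shows "energy s p \<omega> R G \<phi> = (\<integral>\<^sup>+x\<in>G. (\<integral>\<^sup>+y\<in>G.
      ennreal (\<bar>\<phi> x - \<phi> y\<bar> powr p / (norm (x - y) + \<bar>R x - R y\<bar>) powr (s * p)) * w (x - y) \<partial>lborel) \<partial>lborel)"
proof -
  have shift: "AE y in lborel. ennreal (\<omega> (x - y)) = w (x - y)" for x
    by (rule AE_distrD[of "\<lambda>y. x - y" lborel borel]) (use AE in \<open>simp_all only: lborel_distr_reflect, simp\<close>)
  have pull: "(\<integral>\<^sup>+y\<in>G. ennreal (q y * \<omega> (x - y)) \<partial>lborel) = (\<integral>\<^sup>+y\<in>G. ennreal (q y) * w (x - y) \<partial>lborel)"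
    if "\<And>y. 0 \<le> q y" for x and q :: "real ^ 'n \<Rightarrow> real"
  proof (rule nn_integral_cong_AE)
    show "AE y in lborel. ennreal (q y * \<omega> (x - y)) * indicator G y = ennreal (q y) * w (x - y) * indicator G y"
      using shift[of x] by eventually_elim (simp add: ennreal_mult' that)
  qed
  show ?thesis unfolding energy_def nn_integral_completion
    by (intro nn_integral_cong arg_cong2[where f = "(*)"] pull refl) simp
qed

text \<open>
  When the cutoffs differ, one of the two points, say \<open>x\<close>, has \<open>R x > 3 * L\<close> and hence a hole nearby.
  The product rule is then used in the form that leaves \<open>\<phi> y\<close> as coefficient of the difference of
  the cutoffs: \<open>y\<close> may be far from any hole of its own, but it interacts with that of \<open>x\<close>.
\<close>

lemma cutoff_diff_bound:
  fixes \<phi> R :: "real ^ 'n \<Rightarrow> real"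
  assumes s: "0 < s" "s < 1" and p: "1 < p" and L: "0 < L"
    and A: "\<And>z. 3 * L < R z \<Longrightarrow> \<phi> z \<noteq> 0 \<Longrightarrow> z \<in> {x, y} \<Longrightarrow> z \<in> A"
  shows "\<bar>\<phi> x * cutoff L (R x) - \<phi> y * cutoff L (R y)\<bar> powr p / (norm (x - y) + \<bar>R x - R y\<bar>) powr (s * p)
    \<le> 2 powr p * (\<bar>\<phi> x - \<phi> y\<bar> powr p / norm (x - y) powr (s * p)
      + indicator A x * \<bar>\<phi> y\<bar> powr p * (1 / (norm (x - y) + L) powr (s * p))
      + indicator A y * \<bar>\<phi> x\<bar> powr p * (1 / (norm (x - y) + L) powr (s * p)))"
    (is "?lhs \<le> 2 powr p * (?F + ?T x y + ?T y x)")
proof (cases "x = y")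
  case True
  then show ?thesis using p by simp
next
  case False
  define N where "N = norm (x - y)"
  define D where "D = \<bar>R x - R y\<bar>"
  define h where "h = (\<lambda>z. cutoff L (R z))"
  have h: "0 \<le> h z" "h z \<le> 1" for z by (simp_all add: h_def cutoff_bounds)
  have N: "N > 0" and D: "D \<ge> 0" using False by (simp_all add: N_def D_def)
  have den: "1 / (N + D) powr (s * p) \<le> 1 / N powr (s * p)"
    using N D s p by (intro divide_left_mono powr_mono2 mult_pos_pos) auto
  have T0: "0 \<le> ?T u v" for u v by (simp add: indicator_def)
  have ch: "\<bar>h x - h y\<bar> powr p / (N + D) powr (s * p) \<le> 1 / (N + L) powr (s * p)"
    unfolding h_def N_def D_def by (rule cutoff_kernel_le[OF s p L]) simp
  have two: "1 \<le> 2 powr p" using p by (intro ge_one_powr_ge_zero) auto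
  \<comment> \<open>The case without an error term: the energy density of \<open>\<phi>\<close>
    already suffices, as the additional term in the kernel only decreases the left-hand
    side.\<close>
  have plain: ?thesis if "\<bar>\<phi> x * h x - \<phi> y * h y\<bar> \<le> \<bar>\<phi> x - \<phi> y\<bar>"
  proof -
    have "?lhs = \<bar>\<phi> x * h x - \<phi> y * h y\<bar> powr p * (1 / (N + D) powr (s * p))"
      by (simp add: h_def N_def D_def)
    also have "\<dots> \<le> \<bar>\<phi> x - \<phi> y\<bar> powr p * (1 / N powr (s * p))"
      using that p den by (intro mult_mono powr_mono2) auto
    also have "\<dots> = ?F" by (simp add: N_def)
    also have "\<dots> \<le> 2 powr p * ?F" using two mult_right_mono[of 1 "2 powr p" ?F] by simp
    also have "\<dots> \<le> 2 powr p * (?F + ?T x y + ?T y x)"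
      using T0[of x y] T0[of y x] by (intro mult_left_mono) auto
    finally show ?thesis .
  qed
  \<comment> \<open>The case with an error term. Here \<open>c\<close> will be the value of
    \<open>\<phi>\<close> at the point opposite to the one that has the hole.\<close>
  have split: "\<bar>\<phi> x * h x - \<phi> y * h y\<bar> powr p / (N + D) powr (s * p)
      \<le> 2 powr p * (?F + \<bar>c\<bar> powr p * (1 / (N + L) powr (s * p)))"
    if "\<bar>\<phi> x * h x - \<phi> y * h y\<bar> \<le> \<bar>\<phi> x - \<phi> y\<bar> + \<bar>c\<bar> * \<bar>h x - h y\<bar>" for c
  proof -
    have "\<bar>\<phi> x * h x - \<phi> y * h y\<bar> powr p \<le> (\<bar>\<phi> x - \<phi> y\<bar> + \<bar>c\<bar> * \<bar>h x - h y\<bar>) powr p"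
      using that p by (intro powr_mono2) auto
    also have "\<dots> \<le> 2 powr p * (\<bar>\<phi> x - \<phi> y\<bar> powr p + (\<bar>c\<bar> * \<bar>h x - h y\<bar>) powr p)"
      using p by (intro add_powr_le) auto
    finally have "\<bar>\<phi> x * h x - \<phi> y * h y\<bar> powr p * (1 / (N + D) powr (s * p)) \<le>
        2 powr p * (\<bar>\<phi> x - \<phi> y\<bar> powr p + (\<bar>c\<bar> * \<bar>h x - h y\<bar>) powr p) * (1 / (N + D) powr (s * p))"
      by (rule mult_right_mono) simp
    also have "\<dots> = 2 powr p * (\<bar>\<phi> x - \<phi> y\<bar> powr p * (1 / (N + D) powr (s * p))
        + \<bar>c\<bar> powr p * (\<bar>h x - h y\<bar> powr p / (N + D) powr (s * p)))"
      by (simp add: powr_mult algebra_simps)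
    also have "\<dots> \<le> 2 powr p * (\<bar>\<phi> x - \<phi> y\<bar> powr p * (1 / N powr (s * p))
        + \<bar>c\<bar> powr p * (1 / (N + L) powr (s * p)))"
      by (intro mult_left_mono add_mono den ch) auto
    finally show ?thesis by (simp add: N_def)
  qed
  have lhs: "?lhs = \<bar>\<phi> x * h x - \<phi> y * h y\<bar> powr p / (N + D) powr (s * p)"
    by (simp add: h_def N_def D_def)
  have small: "\<bar>a * h z\<bar> \<le> \<bar>a\<bar>" for a z
    using h[of z] by (simp add: abs_mult mult_left_le)
  have same: ?thesis if "h x = h y"
  proof (rule plain)
    have "\<phi> x * h x - \<phi> y * h y = (\<phi> x - \<phi> y) * h y" using that by (simp add: algebra_simps)
    then show "\<bar>\<phi> x * h x - \<phi> y * h y\<bar> \<le> \<bar>\<phi> x - \<phi> y\<bar>" using small by simp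
  qed
  consider "R x \<le> 3 * L" "R y \<le> 3 * L" | "R x > 3 * L" | "R y > 3 * L" by linarith
  then show ?thesis
  proof cases
    case 1
    then show ?thesis using same L by (simp add: h_def cutoff_eq_1)
  next
    case 2
    show ?thesis
    proof (cases "\<phi> x = 0")
      case True
      then show ?thesis using small[of "\<phi> y" y] by (intro plain) simp
    next
      case False
      have "\<phi> x * h x - \<phi> y * h y = (\<phi> x - \<phi> y) * h x + \<phi> y * (h x - h y)" by (simp add: algebra_simps)
      then have "\<bar>\<phi> x * h x - \<phi> y * h y\<bar> \<le> \<bar>\<phi> x - \<phi> y\<bar> + \<bar>\<phi> y\<bar> * \<bar>h x - h y\<bar>"
        using abs_triangle_ineq[of "(\<phi> x - \<phi> y) * h x" "\<phi> y * (h x - h y)"] small[of "\<phi> x - \<phi> y" x]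
        by (simp add: abs_mult)
      from split[OF this] have "?lhs \<le> 2 powr p * (?F + \<bar>\<phi> y\<bar> powr p * (1 / (N + L) powr (s * p)))"
        unfolding lhs .
      also have "\<dots> \<le> 2 powr p * (?F + ?T x y + ?T y x)"
        using A[of x] 2 False T0[of y x] by (intro mult_left_mono) (auto simp: N_def)
      finally show ?thesis .
    qed
  next
    case 3
    show ?thesis
    proof (cases "\<phi> y = 0")
      case True
      then show ?thesis using small[of "\<phi> x" x] by (intro plain) simp
    next
      case False
      have "\<phi> x * h x - \<phi> y * h y = (\<phi> x - \<phi> y) * h y + \<phi> x * (h x - h y)" by (simp add: algebra_simps)
      then have "\<bar>\<phi> x * h x - \<phi> y * h y\<bar> \<le> \<bar>\<phi> x - \<phi> y\<bar> + \<bar>\<phi> x\<bar> * \<bar>h x - h y\<bar>"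
        using abs_triangle_ineq[of "(\<phi> x - \<phi> y) * h y" "\<phi> x * (h x - h y)"] small[of "\<phi> x - \<phi> y" y]
        by (simp add: abs_mult)
      from split[OF this] have "?lhs \<le> 2 powr p * (?F + \<bar>\<phi> x\<bar> powr p * (1 / (N + L) powr (s * p)))"
        unfolding lhs .
      also have "\<dots> \<le> 2 powr p * (?F + ?T x y + ?T y x)"
        using A[of y] 3 False T0[of x y] by (intro mult_left_mono) (auto simp: N_def norm_minus_commute)
      finally show ?thesis .
    qed
  qed
qed

section \<open>Energy of the truncated function\<close>

lemma nn_integral_cmult_add3:
  fixes f g h :: "'a \<Rightarrow> ennreal"
  assumes "f \<in> borel_measurable M" "g \<in> borel_measurable M" "h \<in> borel_measurable M"
  shows "(\<integral>\<^sup>+x. c * (f x + g x + h x) \<partial>M)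
    = c * ((\<integral>\<^sup>+x. f x \<partial>M) + (\<integral>\<^sup>+x. g x \<partial>M) + (\<integral>\<^sup>+x. h x \<partial>M))"
  using assms by (simp add: nn_integral_cmult nn_integral_add)

text \<open>The pointwise bound is integrated. Each of the two error terms is estimated in the
  variable restricted to \<open>A\<close>, with the other one fixed, and costs \<open>M\<close>
  times the energy of \<open>\<phi>\<close>; hence \<open>1 + 2 * M\<close>.\<close>

lemma energy_cutoff_le_aux:
  fixes \<phi> R :: "real ^ 'n \<Rightarrow> real" and w :: "real ^ 'n \<Rightarrow> ennreal"
  assumes s: "0 < s" "s < 1" and p: "1 < p" and L: "0 < L" and t: "0 < t" and K: "0 \<le> K"
    and [measurable]: "\<phi> \<in> borel_measurable borel" "w \<in> borel_measurable borel" "G \<in> sets borel" "A \<in> sets borel"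
    and sd: "strong_doubling p K w"
    and A: "\<And>z. z \<in> G \<Longrightarrow> 3 * L < R z \<Longrightarrow> \<phi> z \<noteq> 0 \<Longrightarrow> z \<in> A"
    and hole: "\<And>x. x \<in> A \<Longrightarrow> \<exists>b. ball b t \<subseteq> {z \<in> G. \<phi> z = 0} \<inter> cube x (3 * L)"
  defines "M \<equiv> 4 ^ CARD('n) * (5 * real CARD('n)) powr p * K * ((8 * L / t) ^ CARD('n) / unit_ball_vol CARD('n)) powr p"
  shows "(\<integral>\<^sup>+x\<in>G. (\<integral>\<^sup>+y\<in>G. ennreal (\<bar>\<phi> x * cutoff L (R x) - \<phi> y * cutoff L (R y)\<bar> powr p /
            (norm (x - y) + \<bar>R x - R y\<bar>) powr (s * p)) * w (x - y) \<partial>lborel) \<partial>lborel)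
    \<le> ennreal (2 powr p * (1 + 2 * M)) *
       (\<integral>\<^sup>+x\<in>G. (\<integral>\<^sup>+y\<in>G. ennreal (\<bar>\<phi> x - \<phi> y\<bar> powr p / norm (x - y) powr (s * p)) * w (x - y) \<partial>lborel) \<partial>lborel)"
    (is "?I \<le> _ * ?E")
proof -
  have M0: "0 \<le> M" using K by (simp add: M_def)
  define Z where "Z = {z \<in> G. \<phi> z = 0}"
  have Z [measurable]: "Z \<in> sets borel" unfolding Z_def by measurable
  define F where "F x y = ennreal (\<bar>\<phi> x - \<phi> y\<bar> powr p / norm (x - y) powr (s * p)) * w (x - y)" for x y
  define k where "k x y = ennreal (1 / (norm (x - y) + L) powr (s * p)) * w (x - y)" for x y
  define f where "f x = ennreal (\<bar>\<phi> x\<bar> powr p)" for x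
  have [measurable]: "f \<in> borel_measurable borel"
    unfolding f_def by measurable
  have [measurable (raw)]: "(\<lambda>x. F (a x) (b x)) \<in> borel_measurable N" "(\<lambda>x. k (a x) (b x)) \<in> borel_measurable N"
    if [measurable]: "a \<in> measurable N borel" "b \<in> measurable N borel"
    for a b and N :: "'z measure"
    unfolding F_def k_def by measurable
  have E: "?E = (\<integral>\<^sup>+x. (\<integral>\<^sup>+y. F x y * indicator G y * indicator G x \<partial>lborel) \<partial>lborel)"
    by (intro nn_integral_cong) (simp add: F_def nn_integral_multc)
  have q: "0 \<le> s * p" "s * p \<le> p" using s p by (auto simp: mult_le_cancel_right1)
  \<comment> \<open>On a hole \<open>\<phi>\<close> vanishes, so
    \<open>\<bar>\<phi> y\<bar> powr p\<close> is the numerator of the energy density and the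
    interaction with the hole is part of the energy.\<close>
  have FZ: "ennreal (1 / norm (x - y) powr (s * p)) * w (x - y) * f y = F x y" if "x \<in> Z" for x y
    using that by (simp add: F_def f_def Z_def mult_ac flip: ennreal_mult)
  have FZ': "ennreal (1 / norm (x - y) powr (s * p)) * w (x - y) * f x = F x y" if "y \<in> Z" for x y
    using that by (simp add: F_def f_def Z_def mult_ac flip: ennreal_mult)
  have f0: "f y = 0" if "y \<in> Z" for y using that p by (simp add: f_def Z_def)
  have hole': "\<And>x. x \<in> A \<Longrightarrow> \<exists>b. ball b t \<subseteq> Z \<inter> cube x (3 * L)" using hole by (simp add: Z_def)
  have left: "(\<integral>\<^sup>+x. k x y * f y * indicator A x \<partial>lborel) \<le> ennreal M * (\<integral>\<^sup>+z. F z y * indicator G z \<partial>lborel)" for y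
  \<comment> \<open>The kernel comparison requires \<open>y \<notin> Z\<close>; for
    \<open>y \<in> Z\<close> the factor \<open>f y\<close> is 0.\<close>
  proof (cases "y \<in> Z")
    case True
    then show ?thesis by (simp add: f0)
  next
    case False
    have "(\<integral>\<^sup>+x\<in>A. k x y \<partial>lborel) \<le> ennreal M * (\<integral>\<^sup>+z\<in>Z. ennreal (1 / norm (z - y) powr (s * p)) * w (z - y) \<partial>lborel)"
      unfolding k_def M_def
      by (rule nn_integral_kernel_le_of_holes[OF _ _ Z t L K q _ strong_doubling_translate[OF _ sd] False hole'])
         (use p in auto)
    then have "(\<integral>\<^sup>+x\<in>A. k x y \<partial>lborel) * f y \<le>
        ennreal M * (\<integral>\<^sup>+z\<in>Z. ennreal (1 / norm (z - y) powr (s * p)) * w (z - y) \<partial>lborel) * f y"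
      by (rule mult_right_mono) simp
    also have "\<dots> = ennreal M * (\<integral>\<^sup>+z. (ennreal (1 / norm (z - y) powr (s * p)) * w (z - y) * indicator Z z) * f y \<partial>lborel)"
      by (subst nn_integral_multc) (auto simp: mult.assoc)
    also have "\<dots> \<le> ennreal M * (\<integral>\<^sup>+z. F z y * indicator G z \<partial>lborel)"
    proof (intro mult_left_mono nn_integral_mono)
      fix z
      show "(ennreal (1 / norm (z - y) powr (s * p)) * w (z - y) * indicator Z z) * f y \<le> F z y * indicator G z"
        using FZ[of z y] by (cases "z \<in> Z") (auto simp: Z_def)
    qed simp
    also have "(\<integral>\<^sup>+x\<in>A. k x y \<partial>lborel) * f y = (\<integral>\<^sup>+x. k x y * indicator A x * f y \<partial>lborel)"
      by (rule nn_integral_multc[symmetric]) simp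
    finally show ?thesis by (simp add: mult_ac)
  qed
  have right: "(\<integral>\<^sup>+y. k x y * f x * indicator A y \<partial>lborel) \<le> ennreal M * (\<integral>\<^sup>+z. F x z * indicator G z \<partial>lborel)" for x
  proof (cases "x \<in> Z")
    case True
    then show ?thesis by (simp add: f0)
  next
    case False
    have "(\<integral>\<^sup>+y\<in>A. k x y \<partial>lborel) \<le> ennreal M * (\<integral>\<^sup>+z\<in>Z. ennreal (1 / norm (x - z) powr (s * p)) * w (x - z) \<partial>lborel)"
      unfolding k_def M_def norm_minus_commute[of x]
      by (rule nn_integral_kernel_le_of_holes[OF _ _ Z t L K q _ strong_doubling_reflect[OF _ sd] False hole'])
         (use p in auto)
    then have "(\<integral>\<^sup>+y\<in>A. k x y \<partial>lborel) * f x \<le>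
        ennreal M * (\<integral>\<^sup>+z\<in>Z. ennreal (1 / norm (x - z) powr (s * p)) * w (x - z) \<partial>lborel) * f x"
      by (rule mult_right_mono) simp
    also have "\<dots> = ennreal M * (\<integral>\<^sup>+z. (ennreal (1 / norm (x - z) powr (s * p)) * w (x - z) * indicator Z z) * f x \<partial>lborel)"
      by (subst nn_integral_multc) (auto simp: mult.assoc)
    also have "\<dots> \<le> ennreal M * (\<integral>\<^sup>+z. F x z * indicator G z \<partial>lborel)"
    proof (intro mult_left_mono nn_integral_mono)
      fix z
      show "(ennreal (1 / norm (x - z) powr (s * p)) * w (x - z) * indicator Z z) * f x \<le> F x z * indicator G z"
        using FZ'[of z x] by (cases "z \<in> Z") (auto simp: Z_def)
    qed simp
    also have "(\<integral>\<^sup>+y\<in>A. k x y \<partial>lborel) * f x = (\<integral>\<^sup>+y. k x y * indicator A y * f x \<partial>lborel)"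
      by (rule nn_integral_multc[symmetric]) simp
    finally show ?thesis by (simp add: mult_ac)
  qed
  let ?T1 = "\<lambda>x y. F x y * indicator G y * indicator G x"
  \<comment> \<open>In the error terms one variable is confined to \<open>A\<close>; the indicator
    of \<open>G\<close> is kept for the other, which stays fixed in the hole estimate.\<close>
  let ?T2 = "\<lambda>x y. k x y * f y * indicator A x * indicator G y"
  let ?T3 = "\<lambda>x y. k x y * f x * indicator A y * indicator G x"
  have I2: "(\<integral>\<^sup>+x. (\<integral>\<^sup>+y. ?T2 x y \<partial>lborel) \<partial>lborel) \<le> ennreal M * ?E"
  proof -
    \<comment> \<open>The hole estimate for \<open>?T2\<close> acts on the outer variable
      \<open>x\<close>, so the order of integration is exchanged before it and restored afterwards.
      For \<open>?T3\<close> it acts on the inner variable directly.\<close>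
    have "(\<integral>\<^sup>+x. (\<integral>\<^sup>+y. ?T2 x y \<partial>lborel) \<partial>lborel) = (\<integral>\<^sup>+y. (\<integral>\<^sup>+x. ?T2 x y \<partial>lborel) \<partial>lborel)"
      by (rule lborel_pair.Fubini') simp
    also have "\<dots> = (\<integral>\<^sup>+y. (\<integral>\<^sup>+x. k x y * f y * indicator A x \<partial>lborel) * indicator G y \<partial>lborel)"
      by (intro nn_integral_cong nn_integral_multc) simp
    also have "\<dots> \<le> (\<integral>\<^sup>+y. ennreal M * (\<integral>\<^sup>+x. F x y * indicator G x \<partial>lborel) * indicator G y \<partial>lborel)"
      by (intro nn_integral_mono mult_right_mono left) simp
    also have "\<dots> = ennreal M * (\<integral>\<^sup>+y. (\<integral>\<^sup>+x. F x y * indicator G x \<partial>lborel) * indicator G y \<partial>lborel)"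
      by (subst nn_integral_cmult[symmetric]) (simp_all add: mult.assoc)
    also have "(\<integral>\<^sup>+y. (\<integral>\<^sup>+x. F x y * indicator G x \<partial>lborel) * indicator G y \<partial>lborel)
       = (\<integral>\<^sup>+y. (\<integral>\<^sup>+x. ?T1 x y \<partial>lborel) \<partial>lborel)"
      by (intro nn_integral_cong, subst nn_integral_multc[symmetric]) (simp_all add: mult_ac)
    also have "\<dots> = ?E" unfolding E by (rule lborel_pair.Fubini') simp
    finally show ?thesis .
  qed
  have I3: "(\<integral>\<^sup>+x. (\<integral>\<^sup>+y. ?T3 x y \<partial>lborel) \<partial>lborel) \<le> ennreal M * ?E"
  proof -
    have "(\<integral>\<^sup>+x. (\<integral>\<^sup>+y. ?T3 x y \<partial>lborel) \<partial>lborel) = (\<integral>\<^sup>+x. (\<integral>\<^sup>+y. k x y * f x * indicator A y \<partial>lborel) * indicator G x \<partial>lborel)"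
      by (intro nn_integral_cong nn_integral_multc) simp
    also have "\<dots> \<le> (\<integral>\<^sup>+x. ennreal M * (\<integral>\<^sup>+y. F x y * indicator G y \<partial>lborel) * indicator G x \<partial>lborel)"
      by (intro nn_integral_mono mult_right_mono right) simp
    also have "\<dots> = ennreal M * (\<integral>\<^sup>+x. (\<integral>\<^sup>+y. F x y * indicator G y \<partial>lborel) * indicator G x \<partial>lborel)"
      by (subst nn_integral_cmult[symmetric]) (simp_all add: mult.assoc)
    finally show ?thesis by (simp add: F_def)
  qed
  have distribute: "ennreal (r * (a + indicator A x * b * d + indicator A y * c * d)) =
      ennreal r * (ennreal a + indicator A x * ennreal b * ennreal d + indicator A y * ennreal c * ennreal d)"
    if "0 \<le> r" "0 \<le> a" "0 \<le> b" "0 \<le> c" "0 \<le> d" for r a b c d :: real and x y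
    using that by (cases "x \<in> A"; cases "y \<in> A") (simp_all add: ennreal_mult ennreal_plus)
  have I: "?I \<le> (\<integral>\<^sup>+x. (\<integral>\<^sup>+y. ennreal (2 powr p) * (?T1 x y + ?T2 x y + ?T3 x y) \<partial>lborel) \<partial>lborel)"
  proof (rule nn_integral_mono)
    fix x
    show "(\<integral>\<^sup>+y. (ennreal (\<bar>\<phi> x * cutoff L (R x) - \<phi> y * cutoff L (R y)\<bar> powr p /
            (norm (x - y) + \<bar>R x - R y\<bar>) powr (s * p)) * w (x - y)) * indicator G y \<partial>lborel) * indicator G x
      \<le> (\<integral>\<^sup>+y. ennreal (2 powr p) * (?T1 x y + ?T2 x y + ?T3 x y) \<partial>lborel)"
    proof (cases "x \<in> G")
      case True
      have "ennreal (\<bar>\<phi> x * cutoff L (R x) - \<phi> y * cutoff L (R y)\<bar> powr p /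
            (norm (x - y) + \<bar>R x - R y\<bar>) powr (s * p)) * w (x - y) * indicator G y
         \<le> ennreal (2 powr p) * (?T1 x y + ?T2 x y + ?T3 x y)" for y
      proof (cases "y \<in> G")
        case y: True
        have "ennreal (\<bar>\<phi> x * cutoff L (R x) - \<phi> y * cutoff L (R y)\<bar> powr p /
            (norm (x - y) + \<bar>R x - R y\<bar>) powr (s * p)) \<le>
          ennreal (2 powr p * (\<bar>\<phi> x - \<phi> y\<bar> powr p / norm (x - y) powr (s * p)
           + indicator A x * \<bar>\<phi> y\<bar> powr p * (1 / (norm (x - y) + L) powr (s * p))
           + indicator A y * \<bar>\<phi> x\<bar> powr p * (1 / (norm (x - y) + L) powr (s * p))))"
          by (intro ennreal_leI cutoff_diff_bound s p L) (use A True y in auto)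
        also have "\<dots> = ennreal (2 powr p) * (ennreal (\<bar>\<phi> x - \<phi> y\<bar> powr p / norm (x - y) powr (s * p))
           + indicator A x * f y * ennreal (1 / (norm (x - y) + L) powr (s * p))
           + indicator A y * f x * ennreal (1 / (norm (x - y) + L) powr (s * p)))"
          unfolding f_def by (rule distribute) auto
        finally have "ennreal (\<bar>\<phi> x * cutoff L (R x) - \<phi> y * cutoff L (R y)\<bar> powr p /
            (norm (x - y) + \<bar>R x - R y\<bar>) powr (s * p)) * w (x - y) \<le> \<dots> * w (x - y)"
          by (rule mult_right_mono) simp
        then show ?thesis
          using True y by (simp add: F_def k_def distrib_left distrib_right mult_ac)
      qed simp
      then show ?thesis using True by (auto intro!: nn_integral_mono)
    qed simp
  qed
  have sum: "(\<integral>\<^sup>+x. (\<integral>\<^sup>+y. ennreal (2 powr p) * (?T1 x y + ?T2 x y + ?T3 x y) \<partial>lborel) \<partial>lborel)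
     = ennreal (2 powr p) * (?E + (\<integral>\<^sup>+x. (\<integral>\<^sup>+y. ?T2 x y \<partial>lborel) \<partial>lborel) + (\<integral>\<^sup>+x. (\<integral>\<^sup>+y. ?T3 x y \<partial>lborel) \<partial>lborel))"
  proof -
    have inner: "(\<integral>\<^sup>+y. ennreal (2 powr p) * (?T1 x y + ?T2 x y + ?T3 x y) \<partial>lborel) =
       ennreal (2 powr p) * ((\<integral>\<^sup>+y. ?T1 x y \<partial>lborel) + (\<integral>\<^sup>+y. ?T2 x y \<partial>lborel) + (\<integral>\<^sup>+y. ?T3 x y \<partial>lborel))" for x
      by (rule nn_integral_cmult_add3) simp_all
    show ?thesis
      unfolding E inner by (rule nn_integral_cmult_add3) simp_all
  qed
  have le: "ennreal (2 powr p) * (?E + (\<integral>\<^sup>+x. (\<integral>\<^sup>+y. ?T2 x y \<partial>lborel) \<partial>lborel) + (\<integral>\<^sup>+x. (\<integral>\<^sup>+y. ?T3 x y \<partial>lborel) \<partial>lborel))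
     \<le> ennreal (2 powr p) * (?E + ennreal M * ?E + ennreal M * ?E)"
    by (intro mult_left_mono add_mono I2 I3) auto
  have const: "ennreal (2 powr p * (1 + 2 * M)) = ennreal (2 powr p) * (1 + ennreal M + ennreal M)"
    using M0 by (simp add: ennreal_mult ennreal_plus) (simp only: mult_2 add.assoc)
  have eq: "ennreal (2 powr p) * (e + ennreal M * e + ennreal M * e) = ennreal (2 powr p * (1 + 2 * M)) * e" for e
    by (simp only: const mult.assoc distrib_right mult_1_left)
  show ?thesis
    by (rule order_trans[OF I]) (rule order_trans[OF eq_refl[OF sum] le[unfolded eq]])
qed

section \<open>Admissibility of the truncated function, choice of \<open>L\<close>, and passage to
  the infimum\<close>

lemma energy_cong:
  assumes "\<And>x. x \<in> G \<Longrightarrow> R x = R' x" "\<And>x. x \<in> G \<Longrightarrow> \<phi> x = \<phi>' x"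
  shows "energy s p \<omega> R G \<phi> = energy s p \<omega> R' G \<phi>'"
  unfolding energy_def
proof (rule nn_integral_cong, goal_cases)
  case (1 x)
  show ?case
  proof (cases "x \<in> G")
    case True
    have "ennreal (\<bar>\<phi> x - \<phi> y\<bar> powr p / (norm (x - y) + \<bar>R x - R y\<bar>) powr (s * p) * \<omega> (x - y)) * indicator G y
      = ennreal (\<bar>\<phi>' x - \<phi>' y\<bar> powr p / (norm (x - y) + \<bar>R' x - R' y\<bar>) powr (s * p) * \<omega> (x - y)) * indicator G y" for y
      using True by (cases "y \<in> G") (simp_all add: assms)
    then show ?thesis by simp
  qed simp
qed

lemma cutoff_mult_in_C0:
  assumes "\<phi> \<in> C0 G" "continuous_on G R"
  shows "(\<lambda>x. \<phi> x * cutoff L (R x)) \<in> C0 G"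
proof -
  let ?\<psi> = "\<lambda>x. \<phi> x * cutoff L (R x)"
  have "closure {x \<in> G. ?\<psi> x \<noteq> 0} \<subseteq> closure {x \<in> G. \<phi> x \<noteq> 0}"
    by (rule closure_mono) auto
  moreover from this have "compact (closure {x \<in> G. ?\<psi> x \<noteq> 0})"
    using assms(1) bounded_subset unfolding C0_def compact_eq_bounded_closed by blast
  moreover have "continuous_on G ?\<psi>"
    using assms unfolding C0_def cutoff_def divide_inverse by (auto intro!: continuous_intros)
  ultimately show ?thesis using assms(1) by (auto simp: C0_def)
qed

lemma borel_measurable_extend_zero:
  fixes f :: "real ^ 'n \<Rightarrow> real"
  assumes "continuous_on G f" "open G"
  shows "(\<lambda>x. indicator G x * f x) \<in> borel_measurable borel"
  using borel_measurable_continuous_on_indicator[OF borel_open[OF assms(2)] assms(1)] by simp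

text \<open>The choice \<open>L = t / \<kappa>\<close> gives
  \<open>8 * L / t = 8 / \<kappa>\<close>. Its power with exponent \<open>n * p\<close> is the only
  source of the factor \<open>\<kappa> powr (- n * p)\<close>, where \<open>n\<close> is the
  dimension.\<close>

lemma energy_cutoff_le:
  fixes \<omega> R \<phi> :: "real ^ 'n \<Rightarrow> real"
  assumes s: "0 < s" "s < 1" and p: "1 < p" and wt: "weight \<omega>" and Ap: "Ap_bound p \<omega> K"
    and k: "0 < \<kappa>" "\<kappa> < 1" and E: "E \<noteq> {}" "compact E" and por: "porous \<kappa> E"
    and G: "open G" and cR: "continuous_on G R"
    and R: "\<forall>x\<in>G. R x \<le> infdist x (frontier G)"
    and t: "0 < t" "t < \<kappa> * diameter E / 4"
    and \<phi>: "\<phi> \<in> C0 G" "\<forall>x\<in>G - dist_nbhd G E t. \<phi> x = 0"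
  shows "energy s p \<omega> R G (\<lambda>x. \<phi> x * cutoff (t / \<kappa>) (R x)) \<le>
     ennreal (\<kappa> powr (- (real CARD('n) * p)) * (2 powr p * (1 + 2 * (4 ^ CARD('n) * (5 * real CARD('n)) powr p * K *
        (8 ^ CARD('n) / unit_ball_vol CARD('n)) powr p)))) * energy s p \<omega> (\<lambda>x. 0) G \<phi>"
proof -
  let ?n = "CARD('n)"
  define L where "L = t / \<kappa>"
  have L: "0 < L" using k t by (simp add: L_def)
  have K: "0 \<le> K" using Ap by (simp add: Ap_bound_def)
  obtain w :: "real ^ 'n \<Rightarrow> ennreal"
    where [measurable]: "w \<in> borel_measurable borel" and w: "AE x in lborel. ennreal (\<omega> x) = w x"
    using weight_borel_representative[OF wt] .
  have sd: "strong_doubling p K w"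
    using Ap_bound_imp_strong_doubling[OF p wt Ap] w by (rule strong_doubling_cong_AE)
  \<comment> \<open>\<open>\<phi>\<close> and \<open>R\<close> are controlled on \<open>G\<close>
    only. Their extensions by zero are Borel measurable on the whole space and have the same
    energies.\<close>
  define \<phi>0 where "\<phi>0 x = indicator G x * \<phi> x" for x
  define R0 where "R0 x = indicator G x * R x" for x
  have [measurable]: "\<phi>0 \<in> borel_measurable borel" "R0 \<in> borel_measurable borel" "G \<in> sets borel"
    using borel_measurable_extend_zero[OF _ G, of \<phi>] borel_measurable_extend_zero[OF cR G] \<phi> G
    by (auto simp: \<phi>0_def[abs_def] R0_def[abs_def] C0_def)
  define A where "A = {x \<in> G. infdist x E < t \<and> 3 * L < R0 x}"
  have [measurable]: "(\<lambda>x. infdist x E) \<in> borel_measurable borel"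
    by (intro borel_measurable_continuous_onI continuous_intros)
  have mA: "A \<in> sets borel" unfolding A_def by measurable
  have \<phi>0: "\<phi>0 x = 0" if "x \<in> G" "t \<le> infdist x E" for x
    using \<phi>(2) that by (simp add: \<phi>0_def dist_nbhd_def)
  have eq: "x \<in> G \<Longrightarrow> \<phi>0 x = \<phi> x" "x \<in> G \<Longrightarrow> R0 x = R x" for x by (simp_all add: \<phi>0_def R0_def)
  define c where "c = 4 ^ ?n * (5 * real ?n) powr p * K * (8 ^ ?n / unit_ball_vol ?n) powr p"
  have c: "0 \<le> c" unfolding c_def using K by (intro mult_nonneg_nonneg) auto
  define M where "M = 4 ^ ?n * (5 * real ?n) powr p * K * ((8 * L / t) ^ ?n / unit_ball_vol ?n) powr p"
  have M: "M = \<kappa> powr (- (real ?n * p)) * c"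
  proof -
    have "8 * L / t = 8 / \<kappa>" using t k by (simp add: L_def)
    moreover have "\<kappa> powr (- real ?n) = 1 / \<kappa> ^ ?n" using k by (simp add: powr_minus_divide powr_realpow)
    ultimately have "(8 * L / t) ^ ?n / unit_ball_vol ?n = \<kappa> powr (- real ?n) * (8 ^ ?n / unit_ball_vol ?n)"
      by (simp add: power_divide)
    moreover have "(\<kappa> powr (- real ?n) * (8 ^ ?n / unit_ball_vol ?n)) powr p
       = \<kappa> powr (- (real ?n * p)) * (8 ^ ?n / unit_ball_vol ?n) powr p"
      by (subst powr_mult) (simp_all add: powr_powr)
    ultimately show ?thesis unfolding M_def c_def by (simp only: mult_ac)
  qed
  have main: "energy s p \<omega> R0 G (\<lambda>x. \<phi>0 x * cutoff L (R0 x)) \<le>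
     ennreal (2 powr p * (1 + 2 * M)) * energy s p \<omega> (\<lambda>x. 0) G \<phi>0"
    unfolding energy_eq_lborel[OF w] M_def diff_self abs_zero add_0_right
  proof (rule energy_cutoff_le_aux[OF s p L t(1) K _ _ _ mA sd])
    show "z \<in> A" if "z \<in> G" "3 * L < R0 z" "\<phi>0 z \<noteq> 0" for z
      using that \<phi>0[of z] by (auto simp: A_def not_le[symmetric])
    fix x assume "x \<in> A"
    then have "x \<in> G" "infdist x E < t" "3 * (t / \<kappa>) < R x" by (auto simp: A_def R0_def L_def)
    from hole_exists[OF k E por R t this]
    obtain b where "ball b t \<subseteq> {z \<in> G. t \<le> infdist z E} \<inter> cube x (3 * L)" by (auto simp: L_def)
    then show "\<exists>b. ball b t \<subseteq> {z \<in> G. \<phi>0 z = 0} \<inter> cube x (3 * L)"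
      using \<phi>0 by (intro exI[of _ b]) blast
  qed measurable
  have "energy s p \<omega> R G (\<lambda>x. \<phi> x * cutoff L (R x)) = energy s p \<omega> R0 G (\<lambda>x. \<phi>0 x * cutoff L (R0 x))"
    by (rule energy_cong) (simp_all add: eq)
  also note main
  also have "energy s p \<omega> (\<lambda>x. 0) G \<phi>0 = energy s p \<omega> (\<lambda>x. 0) G \<phi>"
    by (rule energy_cong) (simp_all add: eq)
  finally have le: "energy s p \<omega> R G (\<lambda>x. \<phi> x * cutoff L (R x)) \<le>
     ennreal (2 powr p * (1 + 2 * M)) * energy s p \<omega> (\<lambda>x. 0) G \<phi>" .
  \<comment> \<open>Since \<open>\<kappa> < 1\<close>, the power of \<open>\<kappa>\<close> is at
    least 1 and can be factored out of the summand 1 as well.\<close>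
  have "ennreal (2 powr p * (1 + 2 * M)) \<le> ennreal (\<kappa> powr (- (real ?n * p)) * (2 powr p * (1 + 2 * c)))"
  proof (rule ennreal_leI)
    have "1 \<le> \<kappa> powr (- (real ?n * p))"
      using k p powr_mono'[of "- (real ?n * p)" 0 \<kappa>] by simp
    then have "1 + 2 * M \<le> \<kappa> powr (- (real ?n * p)) * (1 + 2 * c)" by (simp add: M algebra_simps)
    then have "2 powr p * (1 + 2 * M) \<le> 2 powr p * (\<kappa> powr (- (real ?n * p)) * (1 + 2 * c))"
      by (rule mult_left_mono) simp
    then show "2 powr p * (1 + 2 * M) \<le> \<kappa> powr (- (real ?n * p)) * (2 powr p * (1 + 2 * c))"
      by (simp add: mult_ac)
  qed
  then have "ennreal (2 powr p * (1 + 2 * M)) * energy s p \<omega> (\<lambda>x. 0) G \<phi> \<le>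
     ennreal (\<kappa> powr (- (real ?n * p)) * (2 powr p * (1 + 2 * c))) * energy s p \<omega> (\<lambda>x. 0) G \<phi>"
    by (rule mult_right_mono) simp
  from order_trans[OF le this] show ?thesis unfolding L_def c_def .
qed

text \<open>A positive finite factor is invertible in the extended nonnegative reals, so it can be
  moved to the other side before the infimum is taken.\<close>

lemma ennreal_mult_INF_le:
  fixes a b :: real
  assumes a: "0 < a" and le: "\<And>i. i \<in> I \<Longrightarrow> x \<le> ennreal a * f i"
  shows "x \<le> ennreal a * (INF i\<in>I. f i)"
proof -
  have inv: "ennreal a * ennreal (1 / a) = 1" using a by (simp flip: ennreal_mult)
  have "x * ennreal (1 / a) \<le> (INF i\<in>I. f i)"
  proof (rule INF_greatest)
    fix i assume "i \<in> I"
    from mult_right_mono[OF le[OF this], of "ennreal (1 / a)"]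
    show "x * ennreal (1 / a) \<le> f i" using inv by (simp add: mult_ac) (metis mult.left_commute mult.right_neutral)
  qed
  then have "ennreal a * (x * ennreal (1 / a)) \<le> ennreal a * (INF i\<in>I. f i)" by (rule mult_left_mono) simp
  then show ?thesis using inv by (metis mult.left_commute mult.right_neutral)
qed

theorem theorem7p3:
  "\<exists>C :: real \<Rightarrow> real \<Rightarrow> real.
     (\<forall>p a. 0 < C p a) \<and>
     (\<forall>(s::real) (p::real) (\<omega> :: real ^ 'n \<Rightarrow> real) (\<kappa>::real) (E :: (real ^ 'n) set)
        (G :: (real ^ 'n) set) (R :: real ^ 'n \<Rightarrow> real) (t::real).
        0 < s \<and> s < 1 \<and> 1 < p \<and> Ap_weight p \<omega> \<and>
        0 < \<kappa> \<and> \<kappa> < 1 \<and> E \<noteq> {} \<and> compact E \<and> porous \<kappa> E \<and>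
        open G \<and> bounded G \<and> E \<subseteq> G \<and>
        continuous_on G R \<and> (\<forall>x\<in>E. R x = 0) \<and>
        (\<forall>x\<in>G. 0 \<le> R x \<and> R x \<le> infdist x (frontier G)) \<and>
        0 < t \<and> t < \<kappa> * diameter E / 4 \<and> closure (dist_nbhd G E t) \<subseteq> G
        \<longrightarrow>
        capR s p \<omega> R E (dist_nbhd G E t \<inter> sublevel G R (4 * t / \<kappa>)) G
          \<le> ennreal (\<kappa> powr (- (real CARD('n) * p)) * C p (Ap_const p \<omega>))
             * cap s p \<omega> E (dist_nbhd G E t) G)"
proof -
  \<comment> \<open>The A_p constant is an infimum, so some admissible bound lies below it plus 1.
    The absolute value keeps \<open>C p a\<close> positive for every real \<open>a\<close>.\<close>
  define C :: "real \<Rightarrow> real \<Rightarrow> real" where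
    "C p a = 2 powr p * (1 + 2 * (4 ^ CARD('n) * (5 * real CARD('n)) powr p * (\<bar>a\<bar> + 1) *
        (8 ^ CARD('n) / unit_ball_vol CARD('n)) powr p))" for p a
  have C0: "0 < C p a" for p a
    unfolding C_def by (intro mult_pos_pos add_pos_nonneg mult_nonneg_nonneg) auto
  show ?thesis
  proof (intro exI[of _ C] conjI allI impI C0, elim conjE)
    fix s p \<kappa> t :: real and \<omega> R :: "real ^ 'n \<Rightarrow> real" and E G :: "(real ^ 'n) set"
    assume s: "0 < s" "s < 1" and p: "1 < p" and Ap: "Ap_weight p \<omega>"
      and k: "0 < \<kappa>" "\<kappa> < 1" and E: "E \<noteq> {}" "compact E" "porous \<kappa> E"
      and G: "open G" "E \<subseteq> G" and cR: "continuous_on G R" and R0: "\<forall>x\<in>E. R x = 0"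
      and R: "\<forall>x\<in>G. 0 \<le> R x \<and> R x \<le> infdist x (frontier G)"
      and t: "0 < t" "t < \<kappa> * diameter E / 4"
    have wt: "weight \<omega>" using Ap by (simp add: Ap_weight_def)
    have "{A. Ap_bound p \<omega> A} \<noteq> {}" using Ap by (auto simp: Ap_weight_def)
    then obtain K where K: "Ap_bound p \<omega> K" "K < Ap_const p \<omega> + 1"
      using cInf_lessD[of "{A. Ap_bound p \<omega> A}" "Ap_const p \<omega> + 1"] by (auto simp: Ap_const_def)
    let ?a = "\<kappa> powr (- (real CARD('n) * p)) * C p (Ap_const p \<omega>)"
    have L: "0 < t / \<kappa>" using k t by simp
    show "capR s p \<omega> R E (dist_nbhd G E t \<inter> sublevel G R (4 * t / \<kappa>)) G
          \<le> ennreal ?a * cap s p \<omega> E (dist_nbhd G E t) G"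
      unfolding capR_def[of s p \<omega> "\<lambda>x. 0"]
    proof (rule ennreal_mult_INF_le)
      show "0 < ?a" using C0 k by simp
      fix \<phi> assume "\<phi> \<in> {\<phi> \<in> C0 G. (\<forall>x\<in>E. 1 \<le> \<phi> x) \<and> (\<forall>x\<in>G - dist_nbhd G E t. \<phi> x = 0)}"
      then have \<phi>: "\<phi> \<in> C0 G" "\<forall>x\<in>E. 1 \<le> \<phi> x" "\<forall>x\<in>G - dist_nbhd G E t. \<phi> x = 0" by auto
      let ?\<psi> = "\<lambda>x. \<phi> x * cutoff (t / \<kappa>) (R x)"
      \<comment> \<open>On \<open>E\<close> the function \<open>R\<close> vanishes and the cutoff is
        1. The level \<open>4 * t / \<kappa>\<close> is four times \<open>t / \<kappa>\<close>,
        where the cutoff reaches 0.\<close>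
      have "1 \<le> ?\<psi> x" if "x \<in> E" for x using \<phi>(2) R0 that L by (simp add: cutoff_eq_1)
      moreover have "?\<psi> x = 0" if "x \<in> G - dist_nbhd G E t \<inter> sublevel G R (4 * t / \<kappa>)" for x
        using \<phi>(3) that cutoff_eq_0[OF L, of "R x"] by (auto simp: sublevel_def not_less)
      ultimately have "capR s p \<omega> R E (dist_nbhd G E t \<inter> sublevel G R (4 * t / \<kappa>)) G \<le> energy s p \<omega> R G ?\<psi>"
        unfolding capR_def using cutoff_mult_in_C0[OF \<phi>(1) cR] by (intro INF_lower) auto
      also have "\<dots> \<le> ennreal (\<kappa> powr (- (real CARD('n) * p)) * (2 powr p * (1 + 2 * (4 ^ CARD('n) *
          (5 * real CARD('n)) powr p * K * (8 ^ CARD('n) / unit_ball_vol CARD('n)) powr p)))) *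
          energy s p \<omega> (\<lambda>x. 0) G \<phi>"
        by (rule energy_cutoff_le[OF s p wt K(1) k E G(1) cR _ t \<phi>(1,3)]) (use R in blast)
      also have "\<dots> \<le> ennreal ?a * energy s p \<omega> (\<lambda>x. 0) G \<phi>"
        unfolding C_def using K(2)
        by (intro mult_right_mono ennreal_leI mult_left_mono add_left_mono) auto
      finally show "capR s p \<omega> R E (dist_nbhd G E t \<inter> sublevel G R (4 * t / \<kappa>)) G
        \<le> ennreal ?a * energy s p \<omega> (\<lambda>x. 0) G \<phi>" .
    qed
  qed
qed

end
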